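(* The three maps $KO_{1[(3^4,4^2)]}$, $KO_{2[(3^4,4^2)]}$ and $KNO_{[(3^4,4^2)]}$ are pairwise non-isomorphic; moreover $KO_{1[(3^4,4^2)]}$ and $KO_{2[(3^4,4^2)]}$ are orientable and $KNO_{[(3^4,4^2)]}$ is non-orientable.
   Context: A map is a finite (combinatorial) polyhedral 2-complex whose geometric carrier is a compact connected 2-manifold without boundary; its 2-faces are polygons identified with cycles of distinct vertices. A map is orientable (non-orientable) if its underlying surface is. Two maps are isomorphic if there is a bijection between their vertex sets carrying faces (as cycles) onto faces. The following maps have vertex set $\{0,1,\dots,11\}$; $[a,b,c]$ is a triangle and $[a,b,c,d]$ is the quadrilateral with boundary cycle $a\,b\,c\,d\,a$. $KO_{1[(3^4,4^2)]}$ has faces: $[0,1,8,7]$, $[0,5,6,7]$, $[5,6,11,2]$, $[1,8,10,3]$, $[3,10,9,4]$, $[2,11,9,4]$, $[0,4,5]$, $[0,1,2]$, $[0,3,4]$, $[0,2,3]$, $[6,7,9]$, $[7,8,11]$, $[7,9,10]$, $[7,10,11]$, $[2,3,5]$, $[1,3,5]$, $[6,10,11]$, $[6,8,10]$, $[1,4,5]$, $[1,2,4]$, $[6,8,9]$, $[8,9,11]$. $KO_{2[(3^4,4^2)]}$ has faces: $[0,1,8,7]$, $[0,5,6,7]$, $[5,6,11,3]$, $[1,8,10,4]$, $[4,10,9,2]$, $[3,11,9,2]$, $[0,4,5]$, $[0,1,2]$, $[0,3,4]$, $[0,2,3]$, $[6,7,9]$, $[7,8,11]$, $[7,9,10]$,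 $[7,10,11]$, $[1,3,4]$, $[1,3,5]$, $[6,10,11]$, $[6,8,10]$, $[2,4,5]$, $[1,2,5]$, $[6,8,9]$, $[8,9,11]$. $KNO_{[(3^4,4^2)]}$ has faces: $[0,1,8,7]$, $[0,5,6,7]$, $[5,6,2,11]$, $[1,8,3,10]$, $[10,3,4,9]$, $[11,2,4,9]$, $[0,4,5]$, $[0,1,2]$, $[0,3,4]$, $[0,2,3]$, $[6,7,9]$, $[7,8,11]$, $[7,9,10]$, $[7,10,11]$, $[2,3,6]$, $[3,6,8]$, $[5,10,11]$, $[1,5,10]$, $[1,4,5]$, $[1,2,4]$, $[6,8,9]$, $[8,9,11]$. *)

theory Defs
  imports "HOL-Complex_Analysis.Winding_Numbers"
begin

(* A polygonal face is the cycle that bounds it, and a cycle is represented by its set of edges.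
   So a list and its rotations and reversals denote the same face, and a complex is a set of
   faces of type 'a set set set. *)

definition cyc :: "'a list \<Rightarrow> 'a set set" where
  "cyc xs = {{xs ! i, xs ! (Suc i mod length xs)} | i. i < length xs}"

definition vertices :: "'a set set set \<Rightarrow> 'a set" where
  "vertices K = \<Union> (\<Union> K)"

definition polyhedral_complex :: "'a set set set \<Rightarrow> bool" where
  "polyhedral_complex K \<longleftrightarrow>
     finite K \<and>
     (\<forall>F\<in>K. \<exists>xs. distinct xs \<and> 3 \<le> length xs \<and> F = cyc xs) \<and>
     (\<forall>F\<in>K. \<forall>G\<in>K. F \<noteq> G \<longrightarrow>
        \<Union> F \<inter> \<Union> G = {} \<or> (\<exists>v. \<Union> F \<inter> \<Union> G = {v}) \<or> \<Union> F \<inter> \<Union> G \<in> F \<inter> G)"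

(* The polygon bounded by F is the cone over its boundary cycle from an interior point Inr F.
   It is thus the union of the triangles spanned by Inr F and the edges of F. Points are given by
   their barycentric coordinates, and the topology is the subspace topology of the product
   topology on functions to the reals. *)

definition face_triangle :: "'a set set \<Rightarrow> 'a set \<Rightarrow> ('a + 'a set set \<Rightarrow> real) set" where
  "face_triangle F e =
     {x. (\<forall>p. 0 \<le> x p) \<and> (\<forall>p. p \<notin> insert (Inr F) (Inl ` e) \<longrightarrow> x p = 0) \<and>
         sum x (insert (Inr F) (Inl ` e)) = 1}"

definition geometric_carrier :: "'a set set set \<Rightarrow> ('a + 'a set set \<Rightarrow> real) set" where
  "geometric_carrier K = (\<Union>F\<in>K. \<Union>e\<in>F. face_triangle F e)"

(* A chart maps to the plane, which is identified with the complex numbers. *)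

definition surface_chart :: "'b::topological_space set \<Rightarrow> 'b set \<Rightarrow> ('b \<Rightarrow> complex) \<Rightarrow> bool" where
  "surface_chart S U \<phi> \<longleftrightarrow>
     openin (top_of_set S) U \<and> open (\<phi> ` U) \<and> (\<exists>\<psi>. homeomorphism U (\<phi> ` U) \<phi> \<psi>)"

(* Second countability follows, as S is compact, Hausdorff and locally Euclidean. *)

definition closed_surface :: "'b::topological_space set \<Rightarrow> bool" where
  "closed_surface S \<longleftrightarrow>
     S \<noteq> {} \<and> compact S \<and> connected S \<and> Hausdorff_space (top_of_set S) \<and>
     (\<forall>x\<in>S. \<exists>U \<phi>. x \<in> U \<and> surface_chart S U \<phi>)"

(* Meant for h that is continuous and injective on the open set W: such an h preserves orientation
   iff it maps each positively oriented circle around z in W, whose closed disc lies in W,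
   to a loop that winds once positively around h z. *)

definition orientation_preserving_on :: "complex set \<Rightarrow> (complex \<Rightarrow> complex) \<Rightarrow> bool" where
  "orientation_preserving_on W h \<longleftrightarrow>
     (\<forall>z r. 0 < r \<and> cball z r \<subseteq> W \<longrightarrow> winding_number (h \<circ> circlepath z r) (h z) = 1)"

definition orientable_surface :: "'b::topological_space set \<Rightarrow> bool" where
  "orientable_surface S \<longleftrightarrow>
     (\<exists>\<A>. (\<forall>(U, \<phi>)\<in>\<A>. surface_chart S U \<phi>) \<and> S = (\<Union>(U, \<phi>)\<in>\<A>. U) \<and>
          (\<forall>(U, \<phi>)\<in>\<A>. \<forall>(V, \<psi>)\<in>\<A>.
             orientation_preserving_on (\<phi> ` (U \<inter> V)) (\<psi> \<circ> inv_into U \<phi>)))"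

definition polyhedral_map :: "'a set set set \<Rightarrow> bool" where
  "polyhedral_map K \<longleftrightarrow> polyhedral_complex K \<and> closed_surface (geometric_carrier K)"

definition orientable_map :: "'a set set set \<Rightarrow> bool" where
  "orientable_map K \<longleftrightarrow> polyhedral_map K \<and> orientable_surface (geometric_carrier K)"

definition nonorientable_map :: "'a set set set \<Rightarrow> bool" where
  "nonorientable_map K \<longleftrightarrow> polyhedral_map K \<and> \<not> orientable_surface (geometric_carrier K)"

definition isomorphic_maps :: "'a set set set \<Rightarrow> 'b set set set \<Rightarrow> bool" where
  "isomorphic_maps K L \<longleftrightarrow>
     (\<exists>f. bij_betw f (vertices K) (vertices L) \<and> (\<lambda>F. (\<lambda>e. f ` e) ` F) ` K = L)"

definition KO1 :: "nat set set set" where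
  "KO1 = cyc ` {[0,1,8,7], [0,5,6,7], [5,6,11,2], [1,8,10,3], [3,10,9,4], [2,11,9,4],
     [0,4,5], [0,1,2], [0,3,4], [0,2,3], [6,7,9], [7,8,11], [7,9,10], [7,10,11],
     [2,3,5], [1,3,5], [6,10,11], [6,8,10], [1,4,5], [1,2,4], [6,8,9], [8,9,11]}"

definition KO2 :: "nat set set set" where
  "KO2 = cyc ` {[0,1,8,7], [0,5,6,7], [5,6,11,3], [1,8,10,4], [4,10,9,2], [3,11,9,2],
     [0,4,5], [0,1,2], [0,3,4], [0,2,3], [6,7,9], [7,8,11], [7,9,10], [7,10,11],
     [1,3,4], [1,3,5], [6,10,11], [6,8,10], [2,4,5], [1,2,5], [6,8,9], [8,9,11]}"

definition KNO :: "nat set set set" where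
  "KNO = cyc ` {[0,1,8,7], [0,5,6,7], [5,6,2,11], [1,8,3,10], [10,3,4,9], [11,2,4,9],
     [0,4,5], [0,1,2], [0,3,4], [0,2,3], [6,7,9], [7,8,11], [7,9,10], [7,10,11],
     [2,3,6], [3,6,8], [5,10,11], [1,5,10], [1,4,5], [1,2,4], [6,8,9], [8,9,11]}"

end

theory Submission
  imports Defs "HOL-Complex_Analysis.Riemann_Mapping"
begin

text \<open>Coning every face from an interior point turns a map into a triangulated complex, whose
realisation is the geometric carrier. Around each point \<open>p\<close> of the
triangulation the triangles form a cycle, the link of \<open>p\<close>. The map that sends
\<open>p\<close> to the origin and the link, in cyclic order, to the corners of a regular
polygon, and that is affine on each triangle, is a chart from the open star of
\<open>p\<close> onto the open polygon (\<open>surface_chart_star\<close>). Hence a complex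
with cyclic links is locally a plane, and the rest of what makes it a closed surface is
compactness, the Hausdorff property and connectedness
(\<open>closed_surface_realisation\<close>).

To decide orientability, the winding numbers of small circles are turned into a local degree
of injective continuous maps of the plane. It is \<open>1\<close> or \<open>-1\<close>,
constant on connected open sets, multiplicative under composition, and for affine maps it is
the sign of the determinant. Overlaps of two stars are connected, and on a triangle the
transition between two star charts is affine. So the orientation of a transition is decided
in a single triangle, where it says whether the two links run around that triangle in the
same direction. If all links are coherent, then the star charts are an oriented atlas
(\<open>orientable_realisation\<close>). Conversely an oriented atlas gives each point a
sign, and neighbours have the same sign iff their links are coherent
(\<open>orientable_realisation_signs\<close>); a closed edge path with an odd number of
incoherent steps is then a contradiction.

What remains is finite: the links and their coherence are checked by rewriting on a copy of
the triangulation whose points are numbers. That the maps are not isomorphic is shown by an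
exhaustive search: a bijection of the vertices that carries faces to faces is built up
vertex by vertex, and no partial bijection survives.\<close>

section \<open>Regular polygons and the fan of their sectors\<close>

definition spoke :: "nat \<Rightarrow> nat \<Rightarrow> complex" where
  "spoke n i = cis (2 * pi * i / n)"

lemma spoke_mod: "n > 0 \<Longrightarrow> spoke n (i mod n) = spoke n i"
proof -
  assume n: "n > 0"
  have "real i = real (i div n) * n + real (i mod n)"
    by (metis div_mult_mod_eq of_nat_add of_nat_mult)
  then have "2 * pi * real i / n = 2 * pi * real (i div n) + 2 * pi * real (i mod n) / n"
    using n by (simp add: field_simps)
  then have "cis (2 * pi * i / n) = cis (2 * pi * real (i div n)) * cis (2 * pi * real (i mod n) / n)"
    by (simp only: cis_mult)
  also have "cis (2 * pi * real (i div n)) = 1"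
    by (rule cis_multiple_2pi) simp
  finally show ?thesis by (simp add: spoke_def)
qed

lemma spoke_Suc: "spoke n (Suc i) = spoke n i * cis (2 * pi / n)"
  by (simp add: spoke_def cis_mult add_divide_distrib algebra_simps)

lemma cos_less_cos_outside:
  assumes "0 \<le> \<delta>" "\<delta> < \<theta>" "\<theta> < 2 * pi - \<delta>"
  shows "cos \<theta> < cos \<delta>"
proof (cases "\<theta> \<le> pi")
  case True then show ?thesis using assms by (intro cos_monotone_0_pi) auto
next
  case False
  then have "cos (2 * pi - \<theta>) < cos \<delta>" using assms by (intro cos_monotone_0_pi) auto
  then show ?thesis by simp
qed

text \<open>The distance of a point from the origin in the direction of the midpoint of the
\<open>i\<close>-th edge of the regular \<open>n\<close>-gon. On the corners of the polygon
it attains its maximum exactly at the two ends of that edge. This convexity property is what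
makes the decomposition of the plane into sectors unambiguous.\<close>

definition edge_height :: "nat \<Rightarrow> nat \<Rightarrow> complex \<Rightarrow> real" where
  "edge_height n i z = Re (z * cis (- (2 * pi * i / n + pi / n)))"

lemma edge_height_spoke:
  "edge_height n i (spoke n k) = cos ((2 * (real k - real i) - 1) * pi / n)"
  by (simp add: edge_height_def spoke_def cis_mult field_simps diff_divide_distrib add_divide_distrib)

lemma edge_height_ends:
  assumes "n \<ge> 3"
  shows "edge_height n i (spoke n i) = cos (pi / n)" "edge_height n i (spoke n (Suc i)) = cos (pi / n)"
  by (auto simp: edge_height_spoke)

lemma edge_height_less:
  assumes n: "n \<ge> 3" and i: "i < n" and k: "k < n" "k \<noteq> i" "k \<noteq> Suc i mod n"
  shows "edge_height n i (spoke n k) < cos (pi / n)"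
proof -
  have np: "real n > 0" using n by simp
  consider "k > Suc i" | "k < i" using k i by (cases "Suc i = n") (simp, simp, linarith)
  then show ?thesis
  proof cases
    case 1
    have "1 * (pi / n) < (2 * (real k - real i) - 1) * (pi / n)"
      using 1 np by (intro mult_strict_right_mono) auto
    moreover have "(2 * (real k - real i) - 1) * (pi / n) < (2 * real n - 1) * (pi / n)"
      using k np by (intro mult_strict_right_mono) auto
    ultimately show ?thesis unfolding edge_height_spoke
      using np by (intro cos_less_cos_outside) (auto simp: field_simps)
  next
    case 2
    have 3: "real i + 1 < real n + real k"
    proof (cases "Suc i = n")
      case True then have "k \<noteq> 0" using k n by simp
      then show ?thesis using True by simp
    next
      case False then show ?thesis using i by linarith
    qed
    have "1 * (pi / n) < (1 + 2 * (real i - real k)) * (pi / n)"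
      using 2 np by (intro mult_strict_right_mono) auto
    moreover have "(1 + 2 * (real i - real k)) * (pi / n) < (2 * real n - 1) * (pi / n)"
      using 3 np by (intro mult_strict_right_mono) auto
    ultimately have "cos ((1 + 2 * (real i - real k)) * (pi / n)) < cos (pi / n)"
      using np by (intro cos_less_cos_outside) (auto simp: field_simps)
    moreover have "(2 * (real k - real i) - 1) * pi / n = - ((1 + 2 * (real i - real k)) * (pi / n))"
      by (simp add: algebra_simps diff_divide_distrib add_divide_distrib)
    ultimately show ?thesis unfolding edge_height_spoke by (metis cos_minus)
  qed
qed

definition fan_combination :: "nat \<Rightarrow> (nat \<Rightarrow> real) \<Rightarrow> complex \<Rightarrow> bool" where
  "fan_combination n f z \<longleftrightarrow> (\<forall>k. 0 \<le> f k) \<and>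
     (\<exists>i<n. \<forall>k. k \<noteq> i \<longrightarrow> k \<noteq> Suc i mod n \<longrightarrow> f k = 0) \<and> z = (\<Sum>k<n. of_real (f k) * spoke n k)"

lemma edge_height_sum:
  "edge_height n i (\<Sum>k<m. of_real (f k) * w k) = (\<Sum>k<m. f k * edge_height n i (w k))"
  unfolding edge_height_def sum_distrib_right Re_sum
  by (rule sum.cong) (auto simp: algebra_simps)

lemma sum_two_support:
  fixes f :: "nat \<Rightarrow> 'a :: comm_monoid_add"
  assumes "i < n" "3 \<le> n" "\<And>k. k \<noteq> i \<Longrightarrow> k \<noteq> Suc i mod n \<Longrightarrow> f k = 0"
  shows "sum f {..<n} = f i + f (Suc i mod n)"
proof -
  have ne: "i \<noteq> Suc i mod n" using assms(1,2) by (cases "Suc i = n") auto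
  have "sum f {..<n} = sum f {i, Suc i mod n}"
    using assms by (intro sum.mono_neutral_right) auto
  then show ?thesis using ne by simp
qed

text \<open>Since each edge is extremal, the total weight of a combination is a gauge of the point, and
it is reached only by combinations that are supported on the two spokes at that edge.\<close>

lemma fan_combination_height_le:
  assumes n: "n \<ge> 3" and f: "fan_combination n f z" and i: "i < n"
  shows "edge_height n i z \<le> cos (pi / n) * (\<Sum>k<n. f k)"
    and "edge_height n i z = cos (pi / n) * (\<Sum>k<n. f k) \<longleftrightarrow> (\<forall>k<n. k \<noteq> i \<longrightarrow> k \<noteq> Suc i mod n \<longrightarrow> f k = 0)"
proof -
  have f0: "\<And>k. 0 \<le> f k" and z: "z = (\<Sum>k<n. of_real (f k) * spoke n k)"
    using f by (auto simp: fan_combination_def)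
  have all: "edge_height n i (spoke n k) \<le> cos (pi / n)" if "k < n" for k
    using edge_height_less[OF n i that] edge_height_ends[OF n] spoke_mod[of n "Suc i"] n
    by (cases "k = i"; cases "k = Suc i mod n") auto
  have eq: "cos (pi / n) * (\<Sum>k<n. f k) - edge_height n i z
      = (\<Sum>k<n. f k * (cos (pi / n) - edge_height n i (spoke n k)))"
    unfolding z edge_height_sum
    by (simp add: sum_distrib_left sum_subtractf right_diff_distrib mult.commute[of "cos _"])
  have nn: "0 \<le> f k * (cos (pi / n) - edge_height n i (spoke n k))" if "k < n" for k
    using all[OF that] f0[of k] by simp
  have nn': "0 \<le> (\<Sum>k<n. f k * (cos (pi / n) - edge_height n i (spoke n k)))"
    using nn by (intro sum_nonneg) auto
  show "edge_height n i z \<le> cos (pi / n) * (\<Sum>k<n. f k)"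
    using eq nn' by linarith
  have "edge_height n i z = cos (pi / n) * (\<Sum>k<n. f k) \<longleftrightarrow>
     (\<Sum>k<n. f k * (cos (pi / n) - edge_height n i (spoke n k))) = 0" using eq by linarith
  also have "\<dots> \<longleftrightarrow> (\<forall>k<n. f k * (cos (pi / n) - edge_height n i (spoke n k)) = 0)"
    using nn by (subst sum_nonneg_eq_0_iff) auto
  also have "\<dots> \<longleftrightarrow> (\<forall>k<n. k \<noteq> i \<longrightarrow> k \<noteq> Suc i mod n \<longrightarrow> f k = 0)"
  proof (intro iff_allI imp_cong refl)
    fix k assume k: "k < n"
    show "f k * (cos (pi / n) - edge_height n i (spoke n k)) = 0 \<longleftrightarrow> (k \<noteq> i \<longrightarrow> k \<noteq> Suc i mod n \<longrightarrow> f k = 0)"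
      using edge_height_less[OF n i k] edge_height_ends[OF n, of i] spoke_mod[of n "Suc i"] n
      by (cases "k = i"; cases "k = Suc i mod n") auto
  qed
  finally show "edge_height n i z = cos (pi / n) * (\<Sum>k<n. f k) \<longleftrightarrow> (\<forall>k<n. k \<noteq> i \<longrightarrow> k \<noteq> Suc i mod n \<longrightarrow> f k = 0)" .
qed

lemma sin_sector_pos: "n \<ge> 3 \<Longrightarrow> sin (2 * pi / real n) > 0"
proof (rule sin_gt_zero)
  assume "n \<ge> 3"
  then show "0 < 2 * pi / real n" by simp
  have "2 * pi / real n \<le> 2 * pi / 3" using \<open>n \<ge> 3\<close> by (intro divide_left_mono) auto
  also have "\<dots> < pi" by simp
  finally show "2 * pi / real n < pi" .
qed

lemma Im_cnj_spoke:
  shows "Im (cnj (spoke n i) * spoke n i) = 0"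
    and "Im (cnj (spoke n i) * spoke n (Suc i)) = sin (2 * pi / n)"
    and "Im (cnj (spoke n (Suc i)) * spoke n i) = - sin (2 * pi / n)"
  by (simp_all add: spoke_def cis_cnj cis_mult diff_divide_distrib[symmetric] field_simps
        flip: sin_minus)

text \<open>By Cramer's rule these are the coordinates of a point with respect to the spokes
\<open>i\<close> and \<open>i + 1\<close>; they make sense for \<open>i + 1 = n\<close> as
well, because \<open>spoke n n = spoke n 0\<close>.\<close>

definition left_coord :: "nat \<Rightarrow> nat \<Rightarrow> complex \<Rightarrow> real" where
  "left_coord n i z = - Im (cnj (spoke n (Suc i)) * z) / sin (2 * pi / n)"

definition right_coord :: "nat \<Rightarrow> nat \<Rightarrow> complex \<Rightarrow> real" where
  "right_coord n i z = Im (cnj (spoke n i) * z) / sin (2 * pi / n)"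

lemma sector_coords:
  assumes n: "n \<ge> 3" and z: "z = of_real a * spoke n i + of_real b * spoke n (Suc i)"
  shows "left_coord n i z = a" "right_coord n i z = b"
proof -
  have "Im (w * z) = a * Im (w * spoke n i) + b * Im (w * spoke n (Suc i))" for w
    by (simp add: z algebra_simps)
  then show "left_coord n i z = a" "right_coord n i z = b"
    unfolding left_coord_def right_coord_def using sin_sector_pos[OF n]
    by (simp_all only: Im_cnj_spoke) simp_all
qed

lemma fan_combination_sector:
  assumes n: "n \<ge> 3" and f: "fan_combination n f z" and i: "i < n"
    and supp: "\<forall>k<n. k \<noteq> i \<longrightarrow> k \<noteq> Suc i mod n \<longrightarrow> f k = 0"
  shows "f = (\<lambda>k. if k = i then left_coord n i z else if k = Suc i mod n then right_coord n i z else 0)"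
    and "left_coord n i z = f i" "right_coord n i z = f (Suc i mod n)"
proof -
  obtain j where j: "j < n" "\<forall>k. k \<noteq> j \<longrightarrow> k \<noteq> Suc j mod n \<longrightarrow> f k = 0"
    and z: "z = (\<Sum>k<n. of_real (f k) * spoke n k)"
    using f by (auto simp: fan_combination_def)
  have "f k = 0" if "k \<ge> n" for k using j n that mod_less_divisor[of n "Suc j"]
    by (metis leD gr0I less_le_trans not_numeral_le_zero)
  then have f0: "f k = 0" if "k \<noteq> i" "k \<noteq> Suc i mod n" for k
    using supp that by (cases "k < n") auto
  have "z = of_real (f i) * spoke n i + of_real (f (Suc i mod n)) * spoke n (Suc i mod n)"
    unfolding z using f0 by (intro sum_two_support[OF i n]) auto
  then have "z = of_real (f i) * spoke n i + of_real (f (Suc i mod n)) * spoke n (Suc i)"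
    using spoke_mod[of n "Suc i"] n by simp
  from sector_coords[OF n this]
  show "left_coord n i z = f i" "right_coord n i z = f (Suc i mod n)" .
  then show "f = (\<lambda>k. if k = i then left_coord n i z else if k = Suc i mod n then right_coord n i z else 0)"
    using f0 by auto
qed

text \<open>Two combinations for the same point have the same total weight, as each bounds the other
through the extremal edge of its own sector. Equality forces both into the same sector,
where the coordinates are determined linearly.\<close>

lemma fan_combination_unique:
  assumes n: "n \<ge> 3" and f: "fan_combination n f z" and g: "fan_combination n g z"
  shows "f = g"
proof -
  have c: "cos (pi / n) > 0"
  proof (rule cos_gt_zero)
    show "0 < pi / real n" using n by simp
    show "pi / real n < pi / 2" using n by (intro divide_strict_left_mono) auto
  qed
  obtain i where i: "i < n" "\<forall>k<n. k \<noteq> i \<longrightarrow> k \<noteq> Suc i mod n \<longrightarrow> f k = 0"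
    using f unfolding fan_combination_def by blast
  obtain j where j: "j < n" "\<forall>k<n. k \<noteq> j \<longrightarrow> k \<noteq> Suc j mod n \<longrightarrow> g k = 0"
    using g unfolding fan_combination_def by blast
  have "cos (pi / n) * sum f {..<n} \<le> cos (pi / n) * sum g {..<n}"
    using fan_combination_height_le[OF n g i(1)] fan_combination_height_le(2)[OF n f i(1)] i by simp
  moreover have "cos (pi / n) * sum g {..<n} \<le> cos (pi / n) * sum f {..<n}"
    using fan_combination_height_le[OF n f j(1)] fan_combination_height_le(2)[OF n g j(1)] j by simp
  ultimately have "edge_height n i z = cos (pi / n) * sum g {..<n}"
    using fan_combination_height_le(2)[OF n f i(1)] i by simp
  then have "\<forall>k<n. k \<noteq> i \<longrightarrow> k \<noteq> Suc i mod n \<longrightarrow> g k = 0"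
    using fan_combination_height_le(2)[OF n g i(1)] by simp
  from fan_combination_sector(1)[OF n g i(1) this] fan_combination_sector(1)[OF n f i]
  show ?thesis by simp
qed

text \<open>The sector is read off from the argument of the point, and the coordinates are those given
by the law of sines.\<close>

lemma fan_combination_exists:
  assumes n: "n \<ge> 3"
  shows "\<exists>f. fan_combination n f z"
proof -
  define r where "r = norm z"
  define t where "t = Arg2pi z"
  have t: "0 \<le> t" "t < 2 * pi"
    unfolding t_def by (rule Arg2pi_ge_0, rule Arg2pi_lt_2pi)
  have z: "z = of_real r * cis t"
    unfolding t_def r_def cis_conv_exp by (rule Arg2pi_eq)
  define i where "i = nat \<lfloor>t * n / (2 * pi)\<rfloor>"
  have np: "real n > 0" using n by simp
  have i': "real i \<le> t * n / (2 * pi)" "t * n / (2 * pi) < real i + 1"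
    unfolding i_def using t np by (auto simp: of_nat_nat)
  have "t * n / (2 * pi) < n" using t np by (simp add: field_simps)
  then have i: "i < n" using i' by linarith
  define d where "d = t - 2 * pi * i / n"
  have d: "0 \<le> d" "d \<le> 2 * pi / n"
  proof -
    have "2 * pi * i \<le> t * n" "t * n \<le> 2 * pi * i + 2 * pi"
      using i' by (simp_all add: pos_le_divide_eq pos_divide_less_eq algebra_simps)
    then have "2 * pi * i / n \<le> t" "t \<le> (2 * pi * i + 2 * pi) / n"
      using np by (simp_all add: pos_divide_le_eq pos_le_divide_eq)
    then show "0 \<le> d" "d \<le> 2 * pi / n" by (simp_all add: d_def add_divide_distrib)
  qed
  have s: "sin (2 * pi / n) > 0" by (rule sin_sector_pos[OF n])
  have "2 * pi / n < pi"
  proof -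
    have "2 * pi / real n \<le> 2 * pi / 3" using n by (intro divide_left_mono) auto
    then show ?thesis using pi_gt_zero by linarith
  qed
  then have sd: "sin d \<ge> 0" "sin (2 * pi / n - d) \<ge> 0"
    using d by (auto intro!: sin_ge_zero)
  define a where "a = r * sin (2 * pi / n - d) / sin (2 * pi / n)"
  define b where "b = r * sin d / sin (2 * pi / n)"
  have ab: "a \<ge> 0" "b \<ge> 0" using sd s by (auto simp: a_def b_def r_def)
  have cd: "of_real (sin (2 * pi / n)) * cis d
      = of_real (sin (2 * pi / n - d)) + of_real (sin d) * cis (2 * pi / n)"
    by (rule complex_eqI) (auto simp: sin_diff algebra_simps)
  have cd': "cis d = of_real (sin (2 * pi / n - d) / sin (2 * pi / n))
      + of_real (sin d / sin (2 * pi / n)) * cis (2 * pi / n)"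
    using cd s by (simp add: field_simps)
  have "z = of_real r * (spoke n i * cis d)"
    by (subst z) (simp add: d_def spoke_def cis_mult)
  also have "\<dots> = of_real a * spoke n i + of_real b * spoke n (Suc i)"
    unfolding cd' spoke_Suc a_def b_def by (simp add: algebra_simps)
  finally have zz: "z = of_real a * spoke n i + of_real b * spoke n (Suc i mod n)"
    using spoke_mod[of n "Suc i"] n by simp
  have ne: "i \<noteq> Suc i mod n" using i n by (cases "Suc i = n") auto
  define f where "f = (\<lambda>k. if k = i then a else if k = Suc i mod n then b else 0)"
  have "z = of_real (f i) * spoke n i + of_real (f (Suc i mod n)) * spoke n (Suc i mod n)"
    using zz ne by (auto simp: f_def)
  also have "\<dots> = (\<Sum>k<n. of_real (f k) * spoke n k)"
    by (rule sum_two_support[OF i n, symmetric]) (auto simp: f_def)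
  finally have "fan_combination n f z" unfolding fan_combination_def
    using ab i by (auto simp: f_def)
  then show ?thesis by blast
qed

definition fan_coord :: "nat \<Rightarrow> complex \<Rightarrow> nat \<Rightarrow> real" where
  "fan_coord n z = (THE f. fan_combination n f z)"

lemma fan_coord: "n \<ge> 3 \<Longrightarrow> fan_combination n (fan_coord n z) z"
  unfolding fan_coord_def
  using fan_combination_exists fan_combination_unique by (metis (no_types, lifting) theI)

lemma fan_coord_eq: "n \<ge> 3 \<Longrightarrow> fan_combination n f z \<Longrightarrow> fan_coord n z = f"
  using fan_coord fan_combination_unique by blast

text \<open>The closed sectors form a finite closed cover of the plane, and on each of them the
coordinates are linear.\<close>

lemma continuous_on_fan_coord:
  assumes n: "n \<ge> 3"
  shows "continuous_on UNIV (\<lambda>z. fan_coord n z k)"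
proof -
  define C where "C i = {z. 0 \<le> left_coord n i z} \<inter> {z. 0 \<le> right_coord n i z}" for i
  have cont: "continuous_on A (left_coord n i)" "continuous_on A (right_coord n i)" for A i
    unfolding left_coord_def right_coord_def using sin_sector_pos[OF n]
    by (auto intro!: continuous_intros)
  have "continuous_on (\<Union>i\<in>{..<n}. C i) (\<lambda>z. fan_coord n z k)"
  proof (rule continuous_on_closed_Union)
    show "finite {..<n}" by simp
    show "closed (C i)" for i unfolding C_def
      by (intro closed_Int closed_Collect_le continuous_intros cont)
    fix i assume "i \<in> {..<n}"
    then have i: "i < n" by simp
    have eq: "fan_coord n z k =
        (if k = i then left_coord n i z else if k = Suc i mod n then right_coord n i z else 0)"
      if "z \<in> C i" for z
    proof -
      have ne: "i \<noteq> Suc i mod n" using i n by (cases "Suc i = n") auto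
      define a b where "a = left_coord n i z" and "b = right_coord n i z"
      define f where "f = (\<lambda>k. if k = i then a else if k = Suc i mod n then b else 0)"
      have D: "z = of_real a * spoke n i + of_real b * spoke n (Suc i)"
      proof -
        have s: "sin (2 * pi / n) > 0" by (rule sin_sector_pos[OF n])
        define u where "u = cnj (spoke n i) * z"
        have z: "z = spoke n i * u" by (simp add: u_def spoke_def cis_cnj cis_mult flip: mult.assoc)
        have "cnj (spoke n (Suc i)) * z = cis (- (2 * pi / n)) * u"
          unfolding u_def spoke_Suc complex_cnj_mult cis_cnj by (simp only: mult.assoc mult.left_commute)
        then have "a * sin (2 * pi / n) = sin (2 * pi / n) * Re u - cos (2 * pi / n) * Im u"
          using s by (simp add: a_def left_coord_def)
        moreover have b: "Im u = b * sin (2 * pi / n)"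
          using s by (simp add: b_def right_coord_def u_def)
        ultimately have "sin (2 * pi / n) * Re u = sin (2 * pi / n) * (a + b * cos (2 * pi / n))"
          by (simp add: algebra_simps)
        then have "Re u = a + b * cos (2 * pi / n)" using s by simp
        with b have "u = of_real a + of_real b * cis (2 * pi / n)"
          by (intro complex_eqI) auto
        then have "z = spoke n i * (of_real a + of_real b * cis (2 * pi / n))" using z by simp
        then show ?thesis by (simp add: spoke_Suc algebra_simps)
      qed
      then have "z = of_real (f i) * spoke n i + of_real (f (Suc i mod n)) * spoke n (Suc i mod n)"
        using ne spoke_mod[of n "Suc i"] n by (auto simp: f_def)
      also have "\<dots> = (\<Sum>k<n. of_real (f k) * spoke n k)"
        by (rule sum_two_support[OF i n, symmetric]) (auto simp: f_def)
      finally have "fan_combination n f z" unfolding fan_combination_def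
        using that i by (auto simp: f_def C_def a_def b_def)
      then show ?thesis using fan_coord_eq[OF n] by (simp add: f_def a_def b_def)
    qed
    have "continuous_on (C i) (\<lambda>z. if k = i then left_coord n i z
        else if k = Suc i mod n then right_coord n i z else 0)"
      by (cases "k = i"; cases "k = Suc i mod n") (simp_all add: cont)
    then show "continuous_on (C i) (\<lambda>z. fan_coord n z k)"
      using eq by (subst continuous_on_cong[OF refl]) auto
  qed
  moreover have "(\<Union>i\<in>{..<n}. C i) = UNIV"
  proof -
    have "\<exists>i<n. z \<in> C i" for z
    proof -
      have f: "fan_combination n (fan_coord n z) z" by (rule fan_coord[OF n])
      then obtain i where i: "i < n" "\<forall>k<n. k \<noteq> i \<longrightarrow> k \<noteq> Suc i mod n \<longrightarrow> fan_coord n z k = 0"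
        unfolding fan_combination_def by blast
      have "z \<in> C i" using fan_combination_sector(2,3)[OF n f i] f
        by (auto simp: C_def fan_combination_def)
      then show ?thesis using i by blast
    qed
    then show ?thesis by blast
  qed
  ultimately show ?thesis by simp
qed

section \<open>Realisations of triangle complexes and star charts\<close>

definition std_simplex :: "'p set \<Rightarrow> ('p \<Rightarrow> real) set" where
  "std_simplex T = {x. (\<forall>p. 0 \<le> x p) \<and> (\<forall>p. p \<notin> T \<longrightarrow> x p = 0) \<and> sum x T = 1}"

definition realisation :: "'p set set \<Rightarrow> ('p \<Rightarrow> real) set" where
  "realisation \<T> = (\<Union>T\<in>\<T>. std_simplex T)"

definition star :: "'p set set \<Rightarrow> 'p \<Rightarrow> ('p \<Rightarrow> real) set" where
  "star \<T> p = {x \<in> realisation \<T>. 0 < x p}"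

lemma continuous_on_coordinate: "continuous_on S (\<lambda>x :: 'p \<Rightarrow> real. x p)"
  by (rule continuous_on_subset[OF continuous_on_product_coordinates]) simp

text \<open>A simplex is a closed subset of a product of compact intervals, hence compact by Tychonoff's
theorem.\<close>

lemma compact_simplex:
  assumes "finite T"
  shows "compact (std_simplex T)"
proof -
  let ?B = "PiE UNIV (\<lambda>p. if p \<in> T then {0..1} else {0 :: real})"
  have "compactin (product_topology (\<lambda>_. euclidean) UNIV) ?B"
    by (simp add: compactin_PiE)
  then have "compact ?B" by (simp add: euclidean_product_topology)
  moreover have "closed {x. sum x T = (1 :: real)}"
    by (intro closed_Collect_eq continuous_on_sum continuous_on_coordinate continuous_on_const)
  ultimately have "compact (?B \<inter> {x. sum x T = 1})" by (rule compact_Int_closed)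
  also have "?B \<inter> {x. sum x T = 1} = std_simplex T"
  proof -
    have "x p \<le> 1" if "x \<in> std_simplex T" "p \<in> T" for x p
    proof -
      have "x p \<le> sum x T" using that assms by (intro member_le_sum) (auto simp: std_simplex_def)
      then show ?thesis using that by (simp add: std_simplex_def)
    qed
    then show ?thesis by (fastforce simp: std_simplex_def PiE_iff split: if_split_asm)
  qed
  finally show ?thesis .
qed

lemma compact_realisation:
  assumes "finite \<T>" "\<And>T. T \<in> \<T> \<Longrightarrow> finite T"
  shows "compact (realisation \<T>)"
  unfolding realisation_def using assms by (intro compact_UN compact_simplex) auto

lemma Hausdorff_realisation: "Hausdorff_space (top_of_set (S :: ('p \<Rightarrow> real) set))"
proof (rule Hausdorff_space_subtopology)
  have "Hausdorff_space (product_topology (\<lambda>_ :: 'p. euclidean :: real topology) UNIV)"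
    by (simp add: Hausdorff_space_product_topology)
  then show "Hausdorff_space (euclidean :: ('p \<Rightarrow> real) topology)"
    by (simp add: euclidean_product_topology)
qed

text \<open>The point at time \<open>t\<close> of the segment from \<open>x\<close> to \<open>y\<close>,
as functions to the reals carry no vector space structure here.\<close>

definition mix :: "real \<Rightarrow> ('p \<Rightarrow> real) \<Rightarrow> ('p \<Rightarrow> real) \<Rightarrow> 'p \<Rightarrow> real" where
  "mix t x y = (\<lambda>p. (1 - t) * x p + t * y p)"

lemma mix_in_simplex:
  assumes "x \<in> std_simplex T" "y \<in> std_simplex T" "0 \<le> t" "t \<le> 1"
  shows "mix t x y \<in> std_simplex T"
  using assms by (simp add: std_simplex_def mix_def sum.distrib flip: sum_distrib_left)

lemma connected_component_mix:
  assumes "\<And>t. 0 \<le> t \<Longrightarrow> t \<le> 1 \<Longrightarrow> mix t x y \<in> S"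
  shows "connected_component S x y"
proof (rule connected_componentI)
  show "connected ((\<lambda>t. mix t x y) ` {0..1})"
    unfolding mix_def by (intro connected_continuous_image continuous_intros) auto
  show "x \<in> (\<lambda>t. mix t x y) ` {0..1}"
    by (rule image_eqI[of _ _ 0]) (auto simp: mix_def)
  show "y \<in> (\<lambda>t. mix t x y) ` {0..1}"
    by (rule image_eqI[of _ _ 1]) (auto simp: mix_def)
qed (use assms in auto)

lemma connected_starlike:
  assumes "\<And>x t. x \<in> S \<Longrightarrow> 0 \<le> t \<Longrightarrow> t \<le> 1 \<Longrightarrow> mix t x c \<in> S"
  shows "connected S"
  unfolding connected_iff_connected_component
proof (intro ballI)
  fix x y assume "x \<in> S" "y \<in> S"
  then have "connected_component S x c" "connected_component S y c"
    using assms by (auto intro: connected_component_mix)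
  then show "connected_component S x y"
    by (meson connected_component_sym connected_component_trans)
qed

definition midpoint_of :: "'p \<Rightarrow> 'p \<Rightarrow> 'p \<Rightarrow> real" where
  "midpoint_of p q = (\<lambda>r. (of_bool (r = p) + of_bool (r = q)) / 2)"

lemma midpoint_in_simplex: "finite T \<Longrightarrow> p \<in> T \<Longrightarrow> q \<in> T \<Longrightarrow> midpoint_of p q \<in> std_simplex T"
  by (auto simp: std_simplex_def midpoint_of_def sum.distrib of_bool_def simp flip: sum_divide_distrib)

lemma simplex_pos_imp_mem: "x \<in> std_simplex T \<Longrightarrow> 0 < x p \<Longrightarrow> p \<in> T"
  by (force simp: std_simplex_def)

text \<open>The overlap of two open stars is starlike about the midpoint of the edge that joins the two
centres. For \<open>p = q\<close> this is the star of \<open>p\<close> itself.\<close>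

lemma connected_star_Int:
  assumes "\<And>T. T \<in> \<T> \<Longrightarrow> finite T"
  shows "connected (star \<T> p \<inter> star \<T> q)"
proof (rule connected_starlike[where c = "midpoint_of p q"])
  fix x and t :: real assume x: "x \<in> star \<T> p \<inter> star \<T> q" and t: "0 \<le> t" "t \<le> 1"
  then obtain T where T: "T \<in> \<T>" "x \<in> std_simplex T" "0 < x p" "0 < x q"
    by (auto simp: star_def realisation_def)
  then have pq: "p \<in> T" "q \<in> T" by (auto intro: simplex_pos_imp_mem)
  have "mix t x (midpoint_of p q) \<in> std_simplex T"
    using T pq t assms by (intro mix_in_simplex midpoint_in_simplex) auto
  moreover have "0 < mix t x (midpoint_of p q) r" if "0 < x r" "r = p \<or> r = q" for r
  proof -
    have "midpoint_of p q r > 0" using that(2) by (auto simp: midpoint_of_def)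
    then show ?thesis unfolding mix_def using that(1) t
      by (cases "t = 0") (auto intro: add_nonneg_pos)
  qed
  ultimately show "mix t x (midpoint_of p q) \<in> star \<T> p \<inter> star \<T> q"
    using T by (auto simp: star_def realisation_def)
qed

lemma connected_realisation:
  assumes fin: "\<And>T. T \<in> \<T> \<Longrightarrow> finite T"
    and reach: "\<And>p. p \<in> \<Union>\<T> \<Longrightarrow> (c, p) \<in> {(a, b). \<exists>T\<in>\<T>. a \<in> T \<and> b \<in> T}\<^sup>*"
  shows "connected (realisation \<T>)"
proof -
  have seg: "connected_component (realisation \<T>) x y" if "T \<in> \<T>" "x \<in> std_simplex T" "y \<in> std_simplex T" for T x y
    using that by (intro connected_component_mix) (auto simp: realisation_def intro: mix_in_simplex)
  have vert: "p = c \<or> connected_component (realisation \<T>) (midpoint_of c c) (midpoint_of p p)"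
    if "(c, p) \<in> {(a, b). \<exists>T\<in>\<T>. a \<in> T \<and> b \<in> T}\<^sup>*" for p
    using that
  proof induction
    case (step a b)
    then obtain T where T: "T \<in> \<T>" "a \<in> T" "b \<in> T" by blast
    have "connected_component (realisation \<T>) (midpoint_of a a) (midpoint_of b b)"
      using T fin by (intro seg[OF T(1)] midpoint_in_simplex) auto
    then show ?case using step.IH by (auto intro: connected_component_trans)
  qed simp
  have "connected_component (realisation \<T>) x (midpoint_of c c)" if x: "x \<in> realisation \<T>" for x
  proof -
    obtain T where T: "T \<in> \<T>" "x \<in> std_simplex T" using x by (auto simp: realisation_def)
    then have "T \<noteq> {}" by (auto simp: std_simplex_def)
    then obtain p where p: "p \<in> T" by blast
    have "connected_component (realisation \<T>) x (midpoint_of p p)"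
      using T p fin by (intro seg[OF T(1)] midpoint_in_simplex) auto
    moreover have "p = c \<or> connected_component (realisation \<T>) (midpoint_of c c) (midpoint_of p p)"
      using vert reach p T by blast
    ultimately show ?thesis by (metis connected_component_sym connected_component_trans)
  qed
  then show ?thesis
    unfolding connected_iff_connected_component
    by (metis connected_component_sym connected_component_trans)
qed

definition next_in :: "'p list \<Rightarrow> 'p \<Rightarrow> 'p \<Rightarrow> bool" where
  "next_in xs a b \<longleftrightarrow> (\<exists>i<length xs. a = xs ! i \<and> b = xs ! (Suc i mod length xs))"

text \<open>The triangles at \<open>p\<close> form a disc around \<open>p\<close> whose boundary is the
cycle \<open>L\<close>. This combinatorial condition is what makes the realisation a surface
near \<open>p\<close>. The direction in which \<open>L\<close> runs around \<open>p\<close>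
is a local orientation at \<open>p\<close>.\<close>

definition is_link :: "'p set set \<Rightarrow> 'p \<Rightarrow> 'p list \<Rightarrow> bool" where
  "is_link \<T> p L \<longleftrightarrow> distinct L \<and> 3 \<le> length L \<and> p \<notin> set L \<and>
     (\<forall>T. T \<in> \<T> \<and> p \<in> T \<longleftrightarrow> (\<exists>a b. next_in L a b \<and> T = {p, a, b}))"

text \<open>The chart around \<open>p\<close> sends \<open>p\<close> to the origin, sends its neighbours
to the corners of a regular polygon in the cyclic order given by the link, and is affine on
each triangle.\<close>

definition star_chart :: "'p list \<Rightarrow> ('p \<Rightarrow> real) \<Rightarrow> complex" where
  "star_chart L x = (\<Sum>i<length L. of_real (x (L ! i)) * spoke (length L) i)"

definition star_chart_inverse :: "'p \<Rightarrow> 'p list \<Rightarrow> complex \<Rightarrow> 'p \<Rightarrow> real" where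
  "star_chart_inverse p L z = (\<lambda>q.
     if q = p then 1 - (\<Sum>i<length L. fan_coord (length L) z i)
     else (\<Sum>i<length L. if L ! i = q then fan_coord (length L) z i else 0))"

lemma continuous_on_star_chart: "continuous_on S (star_chart L)"
  unfolding star_chart_def by (intro continuous_intros continuous_on_coordinate)

lemma continuous_on_star_chart_inverse:
  assumes "3 \<le> length L"
  shows "continuous_on S (star_chart_inverse p L)"
proof (rule continuous_on_coordinatewise_then_product)
  have c: "continuous_on S (\<lambda>z. fan_coord (length L) z k)" for k
    by (rule continuous_on_subset[OF continuous_on_fan_coord[OF assms]]) simp
  have d: "continuous_on S (\<lambda>z. if L ! k = q then fan_coord (length L) z k else 0)" for k q
    using c by (cases "L ! k = q") auto
  show "continuous_on S (\<lambda>z. star_chart_inverse p L z q)" for q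
    unfolding star_chart_inverse_def
    by (cases "q = p") (auto intro!: continuous_intros c d)
qed

lemma is_linkD_star:
  assumes L: "is_link \<T> p L" and x: "x \<in> star \<T> p"
  obtains i where "i < length L" "{p, L ! i, L ! (Suc i mod length L)} \<in> \<T>"
    "x \<in> std_simplex {p, L ! i, L ! (Suc i mod length L)}"
proof -
  obtain T where T: "T \<in> \<T>" "x \<in> std_simplex T" "0 < x p"
    using x by (auto simp: star_def realisation_def)
  then have "p \<in> T" by (auto intro: simplex_pos_imp_mem)
  then show ?thesis using L T that unfolding is_link_def next_in_def by metis
qed

lemma star_chart_coords:
  assumes L: "is_link \<T> p L" and x: "x \<in> star \<T> p"
  shows "i < length L \<Longrightarrow> fan_coord (length L) (star_chart L x) i = x (L ! i)"
    and "x p = 1 - (\<Sum>i<length L. x (L ! i))"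
    and "q \<noteq> p \<Longrightarrow> q \<notin> set L \<Longrightarrow> x q = 0"
proof -
  let ?n = "length L"
  have n: "?n \<ge> 3" and dist: "distinct L" and p: "p \<notin> set L" using L by (auto simp: is_link_def)
  obtain j where j: "j < ?n" and xT: "x \<in> std_simplex {p, L ! j, L ! (Suc j mod ?n)}"
    using is_linkD_star[OF L x] by metis
  have sj: "Suc j mod ?n < ?n" using n by (intro mod_less_divisor) linarith
  have ne: "j \<noteq> Suc j mod ?n" using j n by (cases "Suc j = ?n") auto
  define f where "f k = (if k < ?n then x (L ! k) else 0)" for k
  have supp: "f k = 0" if "k \<noteq> j" "k \<noteq> Suc j mod ?n" for k
    using that xT j sj p dist
    by (auto simp: f_def std_simplex_def nth_eq_iff_index_eq in_set_conv_nth)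
  have f: "fan_combination ?n f (star_chart L x)"
    unfolding fan_combination_def star_chart_def
  proof (intro conjI allI)
    show "0 \<le> f k" for k using xT by (simp add: f_def std_simplex_def)
    show "\<exists>i<?n. \<forall>k. k \<noteq> i \<longrightarrow> k \<noteq> Suc i mod ?n \<longrightarrow> f k = 0"
      using j supp by blast
  qed (simp add: f_def)
  show "fan_coord ?n (star_chart L x) i = x (L ! i)" if "i < ?n" for i
    using fan_coord_eq[OF n f] that by (simp add: f_def)
  have "(\<Sum>i<?n. x (L ! i)) = sum f {..<?n}" by (simp add: f_def)
  also have "\<dots> = x (L ! j) + x (L ! (Suc j mod ?n))"
  proof -
    have "sum f {..<?n} = f j + f (Suc j mod ?n)" by (rule sum_two_support[OF j n]) (rule supp)
    then show ?thesis using j sj by (simp add: f_def)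
  qed
  finally have s: "(\<Sum>i<?n. x (L ! i)) = x (L ! j) + x (L ! (Suc j mod ?n))" .
  have neq: "p \<noteq> L ! j" "p \<noteq> L ! (Suc j mod ?n)" "L ! j \<noteq> L ! (Suc j mod ?n)"
    using p j sj dist ne by (auto simp: nth_eq_iff_index_eq)
  then have "x p + (x (L ! j) + x (L ! (Suc j mod ?n))) = 1"
    using xT by (simp add: std_simplex_def)
  then show "x p = 1 - (\<Sum>i<length L. x (L ! i))" using s by simp
  show "x q = 0" if "q \<noteq> p" "q \<notin> set L"
    using that xT j sj by (auto simp: std_simplex_def)
qed

lemma star_chart_inverse_nth:
  assumes L: "is_link \<T> p L" and k: "k < length L"
  shows "star_chart_inverse p L z (L ! k) = fan_coord (length L) z k"
proof -
  have "L ! k \<noteq> p" using L k by (auto simp: is_link_def)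
  moreover have "L ! i = L ! k \<longleftrightarrow> i = k" if "i < length L" for i
    using L k that by (auto simp: is_link_def nth_eq_iff_index_eq)
  then have "(\<Sum>i<length L. if L ! i = L ! k then fan_coord (length L) z i else 0)
      = (\<Sum>i<length L. if i = k then fan_coord (length L) z i else 0)"
    by (intro sum.cong) auto
  ultimately show ?thesis using k by (simp add: star_chart_inverse_def)
qed

lemma star_chart_inverse_outside:
  "q \<noteq> p \<Longrightarrow> q \<notin> set L \<Longrightarrow> star_chart_inverse p L z q = 0"
  by (auto simp: star_chart_inverse_def intro!: sum.neutral)

lemma star_chart_inverse_left:
  assumes L: "is_link \<T> p L" and x: "x \<in> star \<T> p"
  shows "star_chart_inverse p L (star_chart L x) = x"
proof
  fix q
  consider "q = p" | k where "k < length L" "q = L ! k" | "q \<noteq> p" "q \<notin> set L"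
    by (auto simp: in_set_conv_nth)
  then show "star_chart_inverse p L (star_chart L x) q = x q"
  proof cases
    case 1
    then show ?thesis using star_chart_coords(1,2)[OF L x] by (simp add: star_chart_inverse_def)
  next
    case 2
    then show ?thesis using star_chart_coords(1)[OF L x] star_chart_inverse_nth[OF L] by simp
  next
    case 3
    then show ?thesis using star_chart_coords(3)[OF L x] star_chart_inverse_outside[of q p L] by simp
  qed
qed

lemma star_chart_inverse_right:
  assumes L: "is_link \<T> p L"
  shows "star_chart L (star_chart_inverse p L z) = z"
proof -
  have n: "length L \<ge> 3" using L by (simp add: is_link_def)
  have "star_chart L (star_chart_inverse p L z)
      = (\<Sum>i<length L. of_real (fan_coord (length L) z i) * spoke (length L) i)"
    unfolding star_chart_def by (intro sum.cong) (auto simp: star_chart_inverse_nth[OF L])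
  also have "\<dots> = z" using fan_coord[OF n, of z] by (simp add: fan_combination_def)
  finally show ?thesis .
qed

lemma star_chart_inverse_in_star:
  assumes L: "is_link \<T> p L" and z: "(\<Sum>i<length L. fan_coord (length L) z i) < 1"
  shows "star_chart_inverse p L z \<in> star \<T> p"
proof -
  let ?n = "length L" and ?x = "star_chart_inverse p L z" and ?c = "fan_coord (length L) z"
  have n: "?n \<ge> 3" and dist: "distinct L" and p: "p \<notin> set L" using L by (auto simp: is_link_def)
  obtain j where j: "j < ?n" and supp: "\<And>k. k \<noteq> j \<Longrightarrow> k \<noteq> Suc j mod ?n \<Longrightarrow> ?c k = 0"
    and nn: "\<And>k. 0 \<le> ?c k"
    using fan_coord[OF n, of z] unfolding fan_combination_def by blast
  have sj: "Suc j mod ?n < ?n" using n by (intro mod_less_divisor) linarith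
  have ne: "j \<noteq> Suc j mod ?n" using j n by (cases "Suc j = ?n") auto
  let ?T = "{p, L ! j, L ! (Suc j mod ?n)}"
  have neq: "p \<noteq> L ! j" "p \<noteq> L ! (Suc j mod ?n)" "L ! j \<noteq> L ! (Suc j mod ?n)"
    using p j sj dist ne by (auto simp: nth_eq_iff_index_eq)
  have T: "?T \<in> \<T>" using L j unfolding is_link_def next_in_def by blast
  have xp: "?x p = 1 - (\<Sum>i<?n. ?c i)" by (simp add: star_chart_inverse_def)
  have xL: "?x (L ! k) = ?c k" if "k < ?n" for k using star_chart_inverse_nth[OF L that] .
  have "?x \<in> std_simplex ?T"
    unfolding std_simplex_def
  proof (intro CollectI conjI allI impI)
    show "0 \<le> ?x q" for q
    proof -
      consider "q = p" | k where "k < ?n" "q = L ! k" | "q \<noteq> p" "q \<notin> set L"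
        by (auto simp: in_set_conv_nth)
      then show ?thesis by cases (use xp xL nn z star_chart_inverse_outside[of q p L] in auto)
    qed
    show "?x q = 0" if q: "q \<notin> ?T" for q
    proof -
      consider k where "k < ?n" "q = L ! k" | "q \<noteq> p" "q \<notin> set L"
        using q by (auto simp: in_set_conv_nth)
      then show ?thesis
      proof cases
        case 1
        then have "k \<noteq> j" "k \<noteq> Suc j mod ?n" using q by auto
        then show ?thesis using 1 xL supp by simp
      next
        case 2 then show ?thesis by (rule star_chart_inverse_outside)
      qed
    qed
    show "sum ?x ?T = 1"
      using neq xL[OF j] xL[OF sj] xp sum_two_support[OF j n supp] by simp
  qed
  then show ?thesis using T z xp by (auto simp: star_def realisation_def)
qed

text \<open>The coordinate at \<open>p\<close> is positive iff the other coordinates add up to less than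
1, so the image is the open polygon. The description by continuous coordinate functions
shows that it is open.\<close>

lemma star_chart_image:
  assumes L: "is_link \<T> p L"
  shows "star_chart L ` star \<T> p = {z. (\<Sum>i<length L. fan_coord (length L) z i) < 1}"
proof (intro equalityI subsetI)
  fix z assume "z \<in> star_chart L ` star \<T> p"
  then obtain x where x: "x \<in> star \<T> p" "z = star_chart L x" by blast
  then have "(\<Sum>i<length L. fan_coord (length L) z i) = 1 - x p"
    using star_chart_coords(1,2)[OF L x(1)] by simp
  then show "z \<in> {z. (\<Sum>i<length L. fan_coord (length L) z i) < 1}"
    using x by (simp add: star_def)
next
  fix z assume "z \<in> {z. (\<Sum>i<length L. fan_coord (length L) z i) < 1}"
  then show "z \<in> star_chart L ` star \<T> p"
    using star_chart_inverse_in_star[OF L] star_chart_inverse_right[OF L] by (metis imageI mem_Collect_eq)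
qed

lemma openin_star: "openin (top_of_set (realisation \<T>)) (star \<T> p)"
proof -
  have "open {x :: 'a \<Rightarrow> real. 0 < x p}"
    by (intro open_Collect_less continuous_on_const continuous_on_coordinate)
  moreover have "star \<T> p = realisation \<T> \<inter> {x. 0 < x p}" by (auto simp: star_def)
  ultimately show ?thesis by (auto simp: openin_open)
qed

lemma star_chart_homeomorphism:
  assumes L: "is_link \<T> p L"
  shows "homeomorphism (star \<T> p) (star_chart L ` star \<T> p) (star_chart L) (star_chart_inverse p L)"
proof -
  have n: "length L \<ge> 3" using L by (simp add: is_link_def)
  show ?thesis
    unfolding homeomorphism_def
    using star_chart_inverse_left[OF L] star_chart_inverse_right[OF L]
    by (auto simp: continuous_on_star_chart continuous_on_star_chart_inverse[OF n] image_iff)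
qed

lemma surface_chart_star:
  assumes L: "is_link \<T> p L"
  shows "surface_chart (realisation \<T>) (star \<T> p) (star_chart L)"
  unfolding surface_chart_def
proof (intro conjI exI)
  have n: "length L \<ge> 3" using L by (simp add: is_link_def)
  show "open (star_chart L ` star \<T> p)"
    unfolding star_chart_image[OF L]
    by (intro open_Collect_less continuous_on_sum continuous_on_const continuous_on_fan_coord n)
  show "homeomorphism (star \<T> p) (star_chart L ` star \<T> p) (star_chart L) (star_chart_inverse p L)"
    by (rule star_chart_homeomorphism[OF L])
qed (rule openin_star)

lemma realisation_covered:
  assumes "x \<in> realisation \<T>"
  obtains p where "p \<in> \<Union>\<T>" "x \<in> star \<T> p"
proof -
  obtain T where T: "T \<in> \<T>" "x \<in> std_simplex T" using assms by (auto simp: realisation_def)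
  have "\<exists>p\<in>T. 0 < x p"
  proof (rule ccontr)
    assume "\<not> ?thesis"
    then have "sum x T \<le> 0" by (intro sum_nonpos) (auto simp: not_less)
    then show False using T by (simp add: std_simplex_def)
  qed
  then show ?thesis using T assms that by (auto simp: star_def)
qed

lemma closed_surface_realisation:
  assumes fin: "finite \<T>" "\<And>T. T \<in> \<T> \<Longrightarrow> finite T"
    and links: "\<And>p. p \<in> \<Union>\<T> \<Longrightarrow> is_link \<T> p (L p)"
    and c: "c \<in> \<Union>\<T>"
    and reach: "\<And>p. p \<in> \<Union>\<T> \<Longrightarrow> (c, p) \<in> {(a, b). \<exists>T\<in>\<T>. a \<in> T \<and> b \<in> T}\<^sup>*"
  shows "closed_surface (realisation \<T>)"
  unfolding closed_surface_def
proof (intro conjI ballI)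
  obtain T where "T \<in> \<T>" "c \<in> T" using c by blast
  then show "realisation \<T> \<noteq> {}"
    using midpoint_in_simplex[of T c c] fin by (auto simp: realisation_def)
  show "compact (realisation \<T>)" by (rule compact_realisation[OF fin])
  show "connected (realisation \<T>)" by (rule connected_realisation[OF fin(2) reach])
  show "Hausdorff_space (top_of_set (realisation \<T>))" by (rule Hausdorff_realisation)
  fix x assume "x \<in> realisation \<T>"
  then show "\<exists>U \<phi>. x \<in> U \<and> surface_chart (realisation \<T>) U \<phi>"
    using realisation_covered surface_chart_star[OF links] by metis
qed

section \<open>The local degree of injective continuous maps of the plane\<close>

lemma circlepath_in_sphere: "0 \<le> r \<Longrightarrow> circlepath z r t \<in> sphere z r"
  by (simp add: circlepath dist_norm norm_mult)

lemma circlepath_in_cball: "0 \<le> r \<Longrightarrow> circlepath z r t \<in> cball z r"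
  using circlepath_in_sphere[of r z t] by auto

lemma path_image_of_circle:
  assumes "continuous_on (cball z r) h" "0 < r"
  shows "path (h \<circ> circlepath z r)" "pathfinish (h \<circ> circlepath z r) = pathstart (h \<circ> circlepath z r)"
    "path_image (h \<circ> circlepath z r) = h ` sphere z r"
proof -
  have "continuous_on (path_image (circlepath z r)) h"
    using assms by (auto intro: continuous_on_subset)
  then show "path (h \<circ> circlepath z r)" by (intro path_continuous_image) auto
qed (use assms in \<open>auto simp: pathstart_compose pathfinish_compose path_image_compose\<close>)

lemma image_ball_sphere_disjoint:
  assumes "inj_on h (cball z r)"
  shows "h ` ball z r \<inter> h ` sphere z r = {}"
  using assms by (subst inj_on_image_Int[symmetric, of h "cball z r"]) auto

text \<open>Moving and shrinking a circle inside the disc that it bounds does not change the winding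
number of its image: the image curve can be deformed without meeting the image of the
centre, by injectivity, and the image of the disc is connected and off the image of the
circle.\<close>

lemma winding_number_image_circle_shrink:
  assumes h: "continuous_on (cball z r) h" "inj_on h (cball z r)"
    and z': "z' \<in> ball z r" "0 < r'" "cball z' r' \<subseteq> cball z r"
  shows "winding_number (h \<circ> circlepath z' r') (h z') = winding_number (h \<circ> circlepath z r) (h z)"
proof -
  have r: "0 < r" using z'(1) by (metis ball_empty empty_iff not_le)
  have "homotopic_loops (cball z r - {z'}) (circlepath z' r') (circlepath z r)"
  proof (rule homotopic_loops_linear)
    fix t :: real assume "t \<in> {0..1}"
    have "closed_segment (circlepath z' r' t) (circlepath z r t) \<subseteq> cball z r"
      using circlepath_in_cball[of r' z' t] circlepath_in_cball[of r z t] z' r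
      by (intro closed_segment_subset) auto
    moreover have "z' \<notin> closed_segment (circlepath z' r' t) (circlepath z r t)"
    proof
      assume "z' \<in> closed_segment (circlepath z' r' t) (circlepath z r t)"
      then obtain u where u: "0 \<le> u" "u \<le> 1"
        "z' = (1 - u) *\<^sub>R circlepath z' r' t + u *\<^sub>R circlepath z r t"
        by (auto simp: closed_segment_def)
      define e where "e = exp (2 * of_real pi * \<i> * of_real t)"
      have ne: "norm e = 1" by (simp add: e_def)
      have "0 = (1 - u) *\<^sub>R circlepath z' r' t + u *\<^sub>R circlepath z r t - z'" using u(3) by simp
      also have "\<dots> = of_real u * (z - z') + of_real ((1 - u) * r' + u * r) * e"
        unfolding e_def by (simp add: circlepath scaleR_conv_of_real algebra_simps)
      finally have "of_real ((1 - u) * r' + u * r) * e = of_real u * (z' - z)"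
        by (simp add: algebra_simps eq_neg_iff_add_eq_0)
      then have "norm (of_real ((1 - u) * r' + u * r) * e) = norm (of_real u * (z' - z))" by simp
      then have "(1 - u) * r' + u * r = u * norm (z' - z)"
        using u(1,2) z'(2) r by (simp add: norm_mult ne del: of_real_add of_real_mult)
      then have *: "(1 - u) * r' + u * (r - norm (z' - z)) = 0" by (simp add: algebra_simps)
      have lt: "r - norm (z' - z) > 0" using z'(1) by (simp add: dist_norm norm_minus_commute)
      have "0 \<le> (1 - u) * r'" "0 \<le> u * (r - norm (z' - z))" using u z' lt by auto
      with * have "(1 - u) * r' = 0" "u * (r - norm (z' - z)) = 0" by linarith+
      then show False using z'(2) lt by auto
    qed
    ultimately show "closed_segment (circlepath z' r' t) (circlepath z r t) \<subseteq> cball z r - {z'}" by blast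
  qed auto
  then have "homotopic_loops (- {h z'}) (h \<circ> circlepath z' r') (h \<circ> circlepath z r)"
    using h z'(1) by (elim homotopic_loops_continuous_image)
      (auto intro: continuous_on_subset simp: inj_on_def)
  then have "winding_number (h \<circ> circlepath z' r') (h z') = winding_number (h \<circ> circlepath z r) (h z')"
    by (rule winding_number_homotopic_loops)
  also have "\<dots> = winding_number (h \<circ> circlepath z r) (h z)"
  proof (rule winding_number_eq)
    show "connected (h ` ball z r)"
      using h by (intro connected_continuous_image) (auto intro: continuous_on_subset)
    show "h ` ball z r \<inter> path_image (h \<circ> circlepath z r) = {}"
      unfolding path_image_of_circle(3)[OF h(1) r] by (rule image_ball_sphere_disjoint[OF h(2)])
  qed (use path_image_of_circle[OF h(1) r] z' r in auto)
  finally show ?thesis .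
qed

text \<open>The winding number of the image of an infinitesimal circle. Taking the limit over the radius
makes the notion depend only on the germ of \<open>h\<close> at \<open>z\<close>; for
injective continuous \<open>h\<close> the winding number is constant for small radii.\<close>

definition local_degree :: "(complex \<Rightarrow> complex) \<Rightarrow> complex \<Rightarrow> complex" where
  "local_degree h z = Lim (at_right 0) (\<lambda>r. winding_number (h \<circ> circlepath z r) (h z))"

lemma local_degreeI:
  assumes "0 < \<delta>" "\<And>r. 0 < r \<Longrightarrow> r < \<delta> \<Longrightarrow> winding_number (h \<circ> circlepath z r) (h z) = d"
  shows "local_degree h z = d"
  unfolding local_degree_def
proof (rule tendsto_Lim)
  have "\<forall>\<^sub>F r in at_right 0. winding_number (h \<circ> circlepath z r) (h z) = d"
    using assms by (auto simp: eventually_at_right_field)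
  then show "((\<lambda>r. winding_number (h \<circ> circlepath z r) (h z)) \<longlongrightarrow> d) (at_right 0)"
    by (rule tendsto_eventually)
qed simp

lemma local_degree_eq_winding_number:
  assumes "0 < r" "continuous_on (cball z r) h" "inj_on h (cball z r)"
  shows "local_degree h z = winding_number (h \<circ> circlepath z r) (h z)"
  using assms by (intro local_degreeI[of r] winding_number_image_circle_shrink) auto

lemma local_degree_cong:
  assumes "0 < \<delta>" "\<And>w. w \<in> ball z \<delta> \<Longrightarrow> h w = g w"
  shows "local_degree h z = local_degree g z"
proof -
  have "h \<circ> circlepath z r = g \<circ> circlepath z r" if "0 < r" "r < \<delta>" for r
    using circlepath_in_sphere[of r z] that assms(2) by (auto simp: fun_eq_iff dist_commute)
  moreover have "h z = g z" using assms by simp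
  ultimately have "\<forall>\<^sub>F r in at_right 0. winding_number (h \<circ> circlepath z r) (h z)
      = winding_number (g \<circ> circlepath z r) (g z)"
    using assms(1) unfolding eventually_at_right_field by (intro exI[of _ \<delta>]) auto
  then have "((\<lambda>r. winding_number (h \<circ> circlepath z r) (h z)) \<longlongrightarrow> l) (at_right 0)
     \<longleftrightarrow> ((\<lambda>r. winding_number (g \<circ> circlepath z r) (g z)) \<longlongrightarrow> l) (at_right 0)" for l
    by (rule tendsto_cong)
  then show ?thesis by (simp add: local_degree_def t2_space_class.Lim_def)
qed

lemma open_contains_cball_inj:
  assumes "open W" "z \<in> W" "continuous_on W h" "inj_on h W"
  obtains r where "0 < r" "cball z r \<subseteq> W" "continuous_on (cball z r) h" "inj_on h (cball z r)"
  using assms by (metis open_contains_cball continuous_on_subset inj_on_subset)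

text \<open>By invariance of domain the image of the open disc is open, so its frontier lies on the
image of the circle. Hence it is the inside of that Jordan curve, around which the curve
winds once.\<close>

lemma local_degree_cases:
  assumes W: "open W" "z \<in> W" "continuous_on W h" "inj_on h W"
  shows "local_degree h z = 1 \<or> local_degree h z = -1"
proof -
  obtain r where r: "0 < r" and h: "continuous_on (cball z r) h" "inj_on h (cball z r)"
    using open_contains_cball_inj[OF W] by metis
  note p = path_image_of_circle[OF h(1) r]
  let ?K = "h ` sphere z r" and ?B = "h ` ball z r"
  have simple: "simple_path (h \<circ> circlepath z r)"
    using h r by (intro simple_path_continuous_image)
      (auto simp: simple_path_circlepath intro: continuous_on_subset inj_on_subset)
  have disj: "?B \<inter> ?K = {}" by (rule image_ball_sphere_disjoint[OF h(2)])
  have "open ?B" by (rule invariance_of_domain) (use h in \<open>auto intro: continuous_on_subset inj_on_subset\<close>)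
  moreover have "closure ?B \<subseteq> h ` cball z r"
    by (rule closure_minimal) (auto intro!: compact_imp_closed compact_continuous_image h)
  moreover have "h ` cball z r = ?B \<union> ?K" 
  proof -
    have "cball z r = ball z r \<union> sphere z r" by auto
    then show ?thesis by (simp add: image_Un)
  qed
  ultimately have front: "frontier ?B \<subseteq> ?K" by (auto simp: frontier_def interior_open)
  have hz: "h z \<in> ?B" using r by simp
  let ?C = "connected_component_set (- ?K) (h z)"
  have "?C \<subseteq> ?B"
  proof (rule ccontr)
    assume "\<not> ?C \<subseteq> ?B"
    moreover have "h z \<in> ?C"
      using hz disj by (simp only: mem_Collect_eq connected_component_refl_eq) blast
    ultimately have "?C \<inter> frontier ?B \<noteq> {}"
      using hz by (intro connected_Int_frontier connected_connected_component) blast+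
    then show False using front connected_component_subset[of "- ?K" "h z"] by blast
  qed
  moreover have "bounded ?B"
    using h
    by (meson ball_subset_cball bounded_subset compact_cball compact_continuous_image compact_imp_bounded image_mono)
  ultimately have "h z \<in> inside ?K"
    using hz disj by (auto simp: inside_def intro: bounded_subset)
  then have hin: "h z \<in> inside (path_image (h \<circ> circlepath z r))" by (simp only: p(3))
  from simple show ?thesis
    unfolding local_degree_eq_winding_number[OF r h]
    by (rule simple_closed_path_winding_number_inside) (use hin in blast)+
qed

lemma local_degree_constant:
  assumes W: "open W" "connected W" "continuous_on W h" "inj_on h W" and zw: "z \<in> W" "w \<in> W"
  shows "local_degree h z = local_degree h w"
proof (rule connected_local_const[OF W(2) zw], intro ballI)
  fix a assume "a \<in> W"
  then obtain r where r: "0 < r" "cball a r \<subseteq> W" and h: "continuous_on (cball a r) h" "inj_on h (cball a r)"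
    using open_contains_cball_inj[OF W(1) _ W(3,4)] by metis
  have "local_degree h a = local_degree h b" if b: "b \<in> ball a r" for b
  proof -
    obtain s where s: "0 < s" "cball b s \<subseteq> ball a r" using b by (meson open_ball open_contains_cball)
    then have sub: "cball b s \<subseteq> cball a r" by (meson ball_subset_cball order_trans)
    have "local_degree h b = winding_number (h \<circ> circlepath b s) (h b)"
      using s sub h by (intro local_degree_eq_winding_number) (auto intro: continuous_on_subset inj_on_subset)
    also have "\<dots> = winding_number (h \<circ> circlepath a r) (h a)"
      using h b s sub by (intro winding_number_image_circle_shrink) auto
    also have "\<dots> = local_degree h a" using local_degree_eq_winding_number[OF r(1) h] by simp
    finally show ?thesis by simp
  qed
  then show "\<forall>\<^sub>F b in at a within W. local_degree h a = local_degree h b"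
    using r(1) by (auto simp: eventually_at dist_commute intro!: exI[of _ r])
qed

lemma orientation_preserving_on_iff_local_degree:
  assumes W: "open W" "continuous_on W h" "inj_on h W"
  shows "orientation_preserving_on W h \<longleftrightarrow> (\<forall>z\<in>W. local_degree h z = 1)"
proof
  assume h: "orientation_preserving_on W h"
  show "\<forall>z\<in>W. local_degree h z = 1"
  proof
    fix z assume "z \<in> W"
    then obtain r where "0 < r" "cball z r \<subseteq> W" "continuous_on (cball z r) h" "inj_on h (cball z r)"
      using open_contains_cball_inj W by metis
    then show "local_degree h z = 1"
      using h local_degree_eq_winding_number[of r z h] by (auto simp: orientation_preserving_on_def)
  qed
next
  assume h: "\<forall>z\<in>W. local_degree h z = 1"
  show "orientation_preserving_on W h"
    unfolding orientation_preserving_on_def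
  proof (intro allI impI)
    fix z r assume zr: "0 < r \<and> cball z r \<subseteq> W"
    then have "z \<in> W" by auto
    then show "winding_number (h \<circ> circlepath z r) (h z) = 1"
      using h zr W local_degree_eq_winding_number[of r z h] by (metis continuous_on_subset inj_on_subset)
  qed
qed

text \<open>Winding numbers are multiplicative. A loop of winding number \<open>1\<close> or
\<open>-1\<close> is homotopic, in the punctured disc, to the circle or to the reversed
circle. The homotopy provided by the winding number lives in the punctured plane, and a
radial retraction pushes it into the disc on which \<open>g\<close> is defined.\<close>

lemma winding_number_image_loop:
  assumes g: "continuous_on (cball w s) g" "inj_on g (cball w s)" and s: "0 < s"
    and \<gamma>: "path \<gamma>" "pathfinish \<gamma> = pathstart \<gamma>" "path_image \<gamma> \<subseteq> cball w s - {w}"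
    and one: "winding_number \<gamma> w = 1 \<or> winding_number \<gamma> w = -1"
  shows "winding_number (g \<circ> \<gamma>) (g w) = winding_number (g \<circ> circlepath w s) (g w) * winding_number \<gamma> w"
proof -
  define \<rho> where "\<rho> y = w + of_real (min 1 (s / norm (y - w))) * (y - w)" for y
  have \<rho>_id: "\<rho> y = y" if "y \<in> cball w s - {w}" for y
  proof -
    have "min 1 (s / norm (y - w)) = 1" using that by (auto simp: min_def dist_norm norm_minus_commute le_divide_eq)
    then show ?thesis by (simp add: \<rho>_def)
  qed
  have \<rho>_cont: "continuous_on (- {w}) \<rho>"
    unfolding \<rho>_def by (intro continuous_intros) auto
  have \<rho>_range: "\<rho> \<in> - {w} \<rightarrow> cball w s - {w}"
  proof
    fix y assume y: "y \<in> - {w}"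
    then have pos: "0 < norm (y - w)" by simp
    have "norm (\<rho> y - w) = min 1 (s / norm (y - w)) * norm (y - w)"
      using pos s by (simp add: \<rho>_def norm_mult)
    moreover have "\<dots> \<le> s / norm (y - w) * norm (y - w)"
      using pos by (intro mult_right_mono) auto
    moreover have "0 < min 1 (s / norm (y - w)) * norm (y - w)" using pos s by simp
    ultimately show "\<rho> y \<in> cball w s - {w}"
      using pos by (auto simp: dist_norm norm_minus_commute)
  qed
  have fixes_path: "\<rho> (\<eta> t) = \<eta> t"
    if "path_image \<eta> \<subseteq> cball w s - {w}" "0 \<le> t" "t \<le> 1" for \<eta> t
  proof (rule \<rho>_id)
    have "\<eta> t \<in> path_image \<eta>" using that(2,3) by (simp add: path_image_def)
    then show "\<eta> t \<in> cball w s - {w}" using that(1) by blast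
  qed
  have push: "winding_number (g \<circ> \<gamma>) (g w) = winding_number (g \<circ> \<eta>) (g w)"
    if \<eta>: "path \<eta>" "pathfinish \<eta> = pathstart \<eta>" "path_image \<eta> \<subseteq> cball w s - {w}"
      and eq: "winding_number \<gamma> w = winding_number \<eta> w" for \<eta>
  proof -
    have "homotopic_loops (- {w}) \<gamma> \<eta>"
      using \<gamma> \<eta> eq by (subst winding_number_homotopic_loops_eq[symmetric]) auto
    then have "homotopic_loops (cball w s - {w}) (\<rho> \<circ> \<gamma>) (\<rho> \<circ> \<eta>)"
      by (rule homotopic_loops_continuous_image[OF _ \<rho>_cont \<rho>_range])
    then have "homotopic_loops (- {g w}) (g \<circ> (\<rho> \<circ> \<gamma>)) (g \<circ> (\<rho> \<circ> \<eta>))"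
      using g s by (elim homotopic_loops_continuous_image)
        (auto intro: continuous_on_subset simp: inj_on_def)
    then have "winding_number (g \<circ> (\<rho> \<circ> \<gamma>)) (g w) = winding_number (g \<circ> (\<rho> \<circ> \<eta>)) (g w)"
      by (rule winding_number_homotopic_loops)
    moreover have "winding_number (g \<circ> (\<rho> \<circ> \<gamma>)) (g w) = winding_number (g \<circ> \<gamma>) (g w)"
      using fixes_path[OF \<gamma>(3)] by (intro winding_number_cong) simp
    moreover have "winding_number (g \<circ> (\<rho> \<circ> \<eta>)) (g w) = winding_number (g \<circ> \<eta>) (g w)"
      using fixes_path[OF \<eta>(3)] by (intro winding_number_cong) simp
    ultimately show ?thesis by simp
  qed
  have c1: "winding_number (circlepath w s) w = 1" using s by (rule winding_number_circlepath_centre)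
  have cs: "path_image (circlepath w s) \<subseteq> cball w s - {w}" using s by auto
  note p = path_image_of_circle[OF g(1) s]
  from one show ?thesis
  proof
    assume 1: "winding_number \<gamma> w = 1"
    have "winding_number (g \<circ> \<gamma>) (g w) = winding_number (g \<circ> circlepath w s) (g w)"
      using 1 c1 cs by (intro push) auto
    then show ?thesis using 1 by simp
  next
    assume 1: "winding_number \<gamma> w = -1"
    have "winding_number (reversepath (circlepath w s)) w = -1"
      using c1 cs by (subst winding_number_reversepath) auto
    then have "winding_number (g \<circ> \<gamma>) (g w) = winding_number (g \<circ> reversepath (circlepath w s)) (g w)"
      using 1 cs by (intro push) auto
    also have "g \<circ> reversepath (circlepath w s) = reversepath (g \<circ> circlepath w s)"
      by (simp add: reversepath_o o_assoc)
    also have "winding_number \<dots> (g w) = - winding_number (g \<circ> circlepath w s) (g w)"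
      using p g(2) s by (intro winding_number_reversepath) (auto simp: inj_on_def)
    finally show ?thesis using 1 by (simp add: o_def)
  qed
qed

lemma local_degree_compose:
  assumes W: "open W" "z \<in> W" "continuous_on W h" "inj_on h W"
    and V: "open V" "h z \<in> V" "continuous_on V g" "inj_on g V"
  shows "local_degree (g \<circ> h) z = local_degree g (h z) * local_degree h z"
proof -
  obtain s where s: "0 < s" "cball (h z) s \<subseteq> V"
    and g: "continuous_on (cball (h z) s) g" "inj_on g (cball (h z) s)"
    by (rule open_contains_cball_inj[OF V])
  have "open (W \<inter> h -` ball (h z) s)" using W by (intro continuous_open_preimage) auto
  then obtain r where r: "0 < r" "cball z r \<subseteq> W \<inter> h -` ball (h z) s"
    using W(2) s(1) unfolding open_contains_cball by (metis IntI centre_in_ball vimageI)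
  have h: "continuous_on (cball z r) h" "inj_on h (cball z r)"
    using r(2) continuous_on_subset[OF W(3)] inj_on_subset[OF W(4)] by auto
  have sub: "h ` cball z r \<subseteq> cball (h z) s" using r(2) by (auto simp: less_imp_le subset_iff)
  have gh: "continuous_on (cball z r) (g \<circ> h)" "inj_on (g \<circ> h) (cball z r)"
    using continuous_on_compose[OF h(1) continuous_on_subset[OF g(1) sub]]
      comp_inj_on[OF h(2) inj_on_subset[OF g(2) sub]] by auto
  note p = path_image_of_circle[OF h(1) r(1)]
  have wn: "winding_number (h \<circ> circlepath z r) (h z) = local_degree h z"
    using local_degree_eq_winding_number[OF r(1) h] by simp
  have "path_image (h \<circ> circlepath z r) \<subseteq> cball (h z) s - {h z}"
    using sub h(2) r(1) unfolding p(3) by (auto simp: inj_on_def)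
  then have "winding_number (g \<circ> (h \<circ> circlepath z r)) (g (h z))
      = winding_number (g \<circ> circlepath (h z) s) (g (h z)) * winding_number (h \<circ> circlepath z r) (h z)"
    using local_degree_cases[OF W] wn p(1,2) by (intro winding_number_image_loop g s(1)) auto
  then show ?thesis
    using local_degree_eq_winding_number[OF r(1) gh] local_degree_eq_winding_number[OF s(1) g] wn
    by (simp add: o_assoc)
qed

text \<open>A loop that is closer to a round circle than the radius winds as the circle does; the sign
\<open>k\<close> is the direction in which the circle is traversed.\<close>

lemma winding_number_nearby_exp:
  assumes "path \<gamma>" "pathfinish \<gamma> = pathstart \<gamma>" "k = 1 \<or> k = -1" "A \<noteq> 0"
    and near: "\<And>t. t \<in> {0..1} \<Longrightarrow> norm (\<gamma> t - c - A * exp (k * (2 * of_real pi * \<i> * of_real t))) < norm A"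
  shows "winding_number \<gamma> c = k"
proof -
  let ?p = "linepath (Ln A) (Ln A + k * (2 * of_real pi * \<i>))"
  have val: "(exp \<circ> ?p) t = A * exp (k * (2 * of_real pi * \<i> * of_real t))" for t
  proof -
    have "?p t = Ln A + k * (2 * of_real pi * \<i> * of_real t)"
      by (simp add: linepath_def scaleR_conv_of_real algebra_simps)
    then show ?thesis using assms(4) by (simp add: exp_add)
  qed
  have e: "exp (k * (2 * of_real pi * \<i>)) = 1"
    using assms(3) by (auto simp: exp_minus)
  have n: "norm (exp (k * (2 * of_real pi * \<i> * of_real t))) = 1" for t :: real
    using assms(3) by auto
  have "winding_number (exp \<circ> ?p) 0 = k"
    by (subst winding_number_compose_exp) auto
  moreover have "winding_number (\<lambda>t. \<gamma> t - c) 0 = winding_number (exp \<circ> ?p) 0"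
  proof (rule winding_number_nearby_loops_eq)
    show "path (exp \<circ> ?p)" by (intro path_continuous_image continuous_intros) auto
    show "path (\<lambda>t. \<gamma> t - c)" using assms(1) by (simp add: path_def continuous_on_diff)
    show "pathfinish (exp \<circ> ?p) = pathstart (exp \<circ> ?p)"
      using e by (simp add: pathfinish_compose pathstart_compose exp_add)
    show "pathfinish (\<lambda>t. \<gamma> t - c) = pathstart (\<lambda>t. \<gamma> t - c)"
      using assms(2) by (simp add: pathfinish_def pathstart_def)
    show "norm (\<gamma> t - c - (exp \<circ> ?p) t) < norm ((exp \<circ> ?p) t - 0)" if "t \<in> {0..1}" for t
    proof -
      have "norm ((exp \<circ> ?p) t) = norm A" by (simp only: val norm_mult n mult_1_right)
      then show ?thesis using near[OF that] by (simp only: val diff_zero)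
    qed
  qed
  ultimately show ?thesis by (simp add: winding_number_offset[of \<gamma> c])
qed

text \<open>A real affine map is \<open>c + a * w + b * cnj w\<close>; its determinant is \<open>(norm
a)^2 - (norm b)^2\<close>, and the larger one of the two terms dictates the winding number.\<close>

lemma local_degree_real_affine:
  assumes \<delta>: "0 < \<delta>" and h: "\<And>w. w \<in> ball z \<delta> \<Longrightarrow> h w = c + a * w + b * cnj w"
  shows "norm b < norm a \<Longrightarrow> local_degree h z = 1" "norm a < norm b \<Longrightarrow> local_degree h z = -1"
proof -
  have cont: "continuous_on (ball z \<delta>) h"
    by (subst continuous_on_cong[OF refl h]) (auto intro!: continuous_intros)
  have circ: "h (circlepath z r t) - h z - a * of_real r * exp (1 * (2 * of_real pi * \<i> * of_real t))
        = b * of_real r * exp (- 1 * (2 * of_real pi * \<i> * of_real t))"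
    if "0 < r" "r < \<delta>" for r t
  proof -
    have "h (circlepath z r t) - h z = a * (circlepath z r t - z) + b * cnj (circlepath z r t - z)"
      using circlepath_in_sphere[of r z t] that \<delta> by (simp add: h dist_commute algebra_simps)
    also have "circlepath z r t - z = of_real r * exp (2 * of_real pi * \<i> * of_real t)"
      by (simp add: circlepath)
    finally show ?thesis by (simp add: exp_cnj)
  qed
  have path: "path (h \<circ> circlepath z r)" "pathfinish (h \<circ> circlepath z r) = pathstart (h \<circ> circlepath z r)"
    if "0 < r" "r < \<delta>" for r
    using that cont by (auto intro!: path_image_of_circle intro: continuous_on_subset)
  show "local_degree h z = 1" if ab: "norm b < norm a"
  proof (rule local_degreeI[OF \<delta>])
    fix r assume r: "0 < r" "r < \<delta>"
    then show "winding_number (h \<circ> circlepath z r) (h z) = 1"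
      using ab circ[OF r] path[OF r]
      by (intro winding_number_nearby_exp[where A = "a * of_real r"]) (auto simp: norm_mult)
  qed
  show "local_degree h z = -1" if ab: "norm a < norm b"
  proof (rule local_degreeI[OF \<delta>])
    fix r assume r: "0 < r" "r < \<delta>"
    have "h (circlepath z r t) - h z - b * of_real r * exp (- 1 * (2 * of_real pi * \<i> * of_real t))
        = a * of_real r * exp (1 * (2 * of_real pi * \<i> * of_real t))" for t
      using circ[OF r, of t] by (simp add: algebra_simps)
    then show "winding_number (h \<circ> circlepath z r) (h z) = -1"
      using ab r path[OF r]
      by (intro winding_number_nearby_exp[where A = "b * of_real r"]) (auto simp: norm_mult)
  qed
qed

text \<open>The determinant of the real \<open>2\<close> by \<open>2\<close> matrix with columns
\<open>u\<close> and \<open>v\<close>.\<close>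

definition det2 :: "complex \<Rightarrow> complex \<Rightarrow> real" where
  "det2 u v = Im (cnj u * v)"

text \<open>The form in which the degree is computed for transitions: the map is given in terms of a
positively oriented frame \<open>(u, v)\<close>, and the degree is the orientation of the
image frame.\<close>

lemma local_degree_affine:
  assumes \<delta>: "0 < \<delta>" and det: "det2 u v > 0"
    and h: "\<And>x y. p + of_real x * u + of_real y * v \<in> ball z \<delta> \<Longrightarrow>
      h (p + of_real x * u + of_real y * v) = q + of_real x * u' + of_real y * v'"
  shows "det2 u' v' > 0 \<Longrightarrow> local_degree h z = 1" "det2 u' v' < 0 \<Longrightarrow> local_degree h z = -1"
proof -
  define D where "D = u * cnj v - v * cnj u"
  define a where "a = (u' * cnj v - v' * cnj u) / D"
  define b where "b = (u * v' - v * u') / D"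
  have Deq: "D = - 2 * \<i> * of_real (det2 u v)"
    by (simp add: D_def det2_def complex_eq_iff algebra_simps)
  then have D0: "D \<noteq> 0" using det by simp
  have Da: "D * a = u' * cnj v - v' * cnj u" and Db: "D * b = u * v' - v * u'"
    using D0 by (simp_all add: a_def b_def)
  have u': "u' = a * u + b * cnj u"
  proof -
    have "D * (a * u + b * cnj u) = (D * a) * u + (D * b) * cnj u" by (simp add: algebra_simps)
    also have "\<dots> = D * u'" unfolding Da Db by (simp add: D_def algebra_simps)
    finally have "D * u' = D * (a * u + b * cnj u)" ..
    then show ?thesis using D0 by simp
  qed
  have v': "v' = a * v + b * cnj v"
  proof -
    have "D * (a * v + b * cnj v) = (D * a) * v + (D * b) * cnj v" by (simp add: algebra_simps)
    also have "\<dots> = D * v'" unfolding Da Db by (simp add: D_def algebra_simps)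
    finally have "D * v' = D * (a * v + b * cnj v)" ..
    then show ?thesis using D0 by simp
  qed
  have det': "det2 u' v' = ((norm a)\<^sup>2 - (norm b)\<^sup>2) * det2 u v"
    unfolding u' v' cmod_power2 by (simp add: det2_def algebra_simps power2_eq_square)
  have span: "\<exists>x y. w = p + of_real x * u + of_real y * v" for w
  proof -
    let ?x = "det2 (w - p) v / det2 u v" and ?y = "det2 u (w - p) / det2 u v"
    have "of_real (det2 u v) * (w - p) = of_real (det2 (w - p) v) * u + of_real (det2 u (w - p)) * v"
      by (simp add: det2_def complex_eq_iff algebra_simps)
    then have "w = p + of_real ?x * u + of_real ?y * v"
      using det by (simp add: field_simps)
    then show ?thesis by blast
  qed
  have "h w = (q - a * p - b * cnj p) + a * w + b * cnj w" if "w \<in> ball z \<delta>" for w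
  proof -
    obtain x y where "w = p + of_real x * u + of_real y * v" using span by blast
    then show ?thesis using h[of x y] that by (simp add: u' v' algebra_simps)
  qed
  note aff = local_degree_real_affine[OF \<delta> this]
  show "local_degree h z = 1" if pos: "det2 u' v' > 0"
  proof (rule aff(1))
    have "0 < (norm a)\<^sup>2 - (norm b)\<^sup>2"
      using pos unfolding det' by (rule zero_less_mult_pos2) (rule det)
    then show "norm b < norm a" by (intro power2_less_imp_less[of "norm b" "norm a"]) simp_all
  qed
  show "local_degree h z = -1" if neg: "det2 u' v' < 0"
  proof (rule aff(2))
    have "0 < ((norm b)\<^sup>2 - (norm a)\<^sup>2) * det2 u v"
      using neg unfolding det' by (simp add: left_diff_distrib)
    then have "0 < (norm b)\<^sup>2 - (norm a)\<^sup>2" by (rule zero_less_mult_pos2) (rule det)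
    then show "norm a < norm b" by (intro power2_less_imp_less[of "norm a" "norm b"]) simp_all
  qed
qed

section \<open>Orientability of realisations\<close>

lemma surface_chart_inj: "surface_chart S U \<phi> \<Longrightarrow> inj_on \<phi> U"
  by (metis surface_chart_def homeomorphism_apply1 inj_on_inverseI)

lemma chart_transition:
  assumes U: "surface_chart S U \<phi>" and V: "surface_chart S V \<psi>"
  shows "open (\<phi> ` (U \<inter> V))" "continuous_on (\<phi> ` (U \<inter> V)) (\<psi> \<circ> inv_into U \<phi>)"
    "inj_on (\<psi> \<circ> inv_into U \<phi>) (\<phi> ` (U \<inter> V))"
proof -
  obtain g where g: "homeomorphism U (\<phi> ` U) \<phi> g" using U by (auto simp: surface_chart_def)
  obtain k where k: "homeomorphism V (\<psi> ` V) \<psi> k" using V by (auto simp: surface_chart_def)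
  have inv: "inv_into U \<phi> (\<phi> x) = x" if "x \<in> U" for x
    using surface_chart_inj[OF U] that by (rule inv_into_f_f)
  have "openin (top_of_set U) (U \<inter> V)"
    using U V unfolding surface_chart_def by (meson openin_Int openin_imp_subset openin_subset_trans inf_le1)
  then have "openin (top_of_set (\<phi> ` U)) (\<phi> ` (U \<inter> V))"
    using homeomorphism_imp_open_map[OF g] by blast
  then show "open (\<phi> ` (U \<inter> V))"
    using U unfolding surface_chart_def by (meson openin_open_trans)
  have "continuous_on (\<phi> ` (U \<inter> V)) (\<psi> \<circ> g)"
  proof (rule continuous_on_compose)
    show "continuous_on (\<phi> ` (U \<inter> V)) g"
      using homeomorphism_cont2[OF g] by (rule continuous_on_subset) auto
    have "g ` \<phi> ` (U \<inter> V) \<subseteq> V" using homeomorphism_apply1[OF g] by auto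
    then show "continuous_on (g ` \<phi> ` (U \<inter> V)) \<psi>"
      using homeomorphism_cont1[OF k] by (rule continuous_on_subset[rotated])
  qed
  then show "continuous_on (\<phi> ` (U \<inter> V)) (\<psi> \<circ> inv_into U \<phi>)"
    by (rule continuous_on_eq) (use inv homeomorphism_apply1[OF g] in auto)
  show "inj_on (\<psi> \<circ> inv_into U \<phi>) (\<phi> ` (U \<inter> V))"
    using surface_chart_inj[OF V] inv by (auto simp: inj_on_def)
qed

text \<open>The sign with which two charts compare at a point.\<close>

definition transition_degree :: "'b set \<Rightarrow> ('b \<Rightarrow> complex) \<Rightarrow> ('b \<Rightarrow> complex) \<Rightarrow> 'b \<Rightarrow> complex" where
  "transition_degree U \<phi> \<psi> x = local_degree (\<psi> \<circ> inv_into U \<phi>) (\<phi> x)"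

lemma transition_degree_cases:
  assumes "surface_chart S U \<phi>" "surface_chart S V \<psi>" "x \<in> U \<inter> V"
  shows "transition_degree U \<phi> \<psi> x = 1 \<or> transition_degree U \<phi> \<psi> x = -1"
  unfolding transition_degree_def
  by (rule local_degree_cases[OF chart_transition(1)[OF assms(1,2)] _ chart_transition(2,3)[OF assms(1,2)]])
    (use assms(3) in auto)

lemma transition_degree_self:
  assumes U: "surface_chart S U \<phi>" "x \<in> U"
  shows "transition_degree U \<phi> \<phi> x = 1"
proof -
  have "open (\<phi> ` U)" using U by (simp add: surface_chart_def)
  then obtain \<delta> where \<delta>: "0 < \<delta>" "ball (\<phi> x) \<delta> \<subseteq> \<phi> ` U" using U(2) by (meson imageI open_contains_ball)
  have id: "(\<phi> \<circ> inv_into U \<phi>) w = 0 + 1 * w + 0 * cnj w" if "w \<in> ball (\<phi> x) \<delta>" for w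
  proof -
    have "w \<in> \<phi> ` U" using \<delta>(2) that by blast
    then show ?thesis by (simp add: f_inv_into_f)
  qed
  show ?thesis
    unfolding transition_degree_def by (rule local_degree_real_affine(1)[OF \<delta>(1) id]) auto
qed

text \<open>Comparing charts is multiplicative, by the chain rule for local degrees.\<close>

lemma transition_degree_cocycle:
  assumes U: "surface_chart S U \<phi>" and V: "surface_chart S V \<psi>" and Z: "surface_chart S Z \<eta>"
    and x: "x \<in> U" "x \<in> V" "x \<in> Z"
  shows "transition_degree U \<phi> \<eta> x = transition_degree V \<psi> \<eta> x * transition_degree U \<phi> \<psi> x"
proof -
  have inv: "inv_into U \<phi> (\<phi> y) = y" if "y \<in> U" for y
    using surface_chart_inj[OF U] that by (rule inv_into_f_f)
  have inv': "inv_into V \<psi> (\<psi> y) = y" if "y \<in> V" for y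
    using surface_chart_inj[OF V] that by (rule inv_into_f_f)
  have "\<phi> x \<in> \<phi> ` (U \<inter> V)" using x by auto
  then obtain \<delta> where \<delta>: "0 < \<delta>" "ball (\<phi> x) \<delta> \<subseteq> \<phi> ` (U \<inter> V)"
    using chart_transition(1)[OF U V] by (meson open_contains_ball)
  have "local_degree (\<eta> \<circ> inv_into U \<phi>) (\<phi> x)
      = local_degree ((\<eta> \<circ> inv_into V \<psi>) \<circ> (\<psi> \<circ> inv_into U \<phi>)) (\<phi> x)"
  proof (rule local_degree_cong[OF \<delta>(1)])
    fix w assume "w \<in> ball (\<phi> x) \<delta>"
    then obtain y where "y \<in> U \<inter> V" "w = \<phi> y" using \<delta>(2) by blast
    then show "(\<eta> \<circ> inv_into U \<phi>) w = ((\<eta> \<circ> inv_into V \<psi>) \<circ> (\<psi> \<circ> inv_into U \<phi>)) w"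
      by (simp add: inv inv')
  qed
  also have "\<dots> = local_degree (\<eta> \<circ> inv_into V \<psi>) ((\<psi> \<circ> inv_into U \<phi>) (\<phi> x))
      * local_degree (\<psi> \<circ> inv_into U \<phi>) (\<phi> x)"
    by (rule local_degree_compose[OF chart_transition(1)[OF U V] _ chart_transition(2,3)[OF U V]
          chart_transition(1)[OF V Z] _ chart_transition(2,3)[OF V Z]])
      (use x inv in auto)
  finally show ?thesis using x by (simp add: transition_degree_def inv)
qed

lemma orientation_preserving_transition_iff:
  assumes U: "surface_chart S U \<phi>" and V: "surface_chart S V \<psi>"
  shows "orientation_preserving_on (\<phi> ` (U \<inter> V)) (\<psi> \<circ> inv_into U \<phi>)
     \<longleftrightarrow> (\<forall>x\<in>U \<inter> V. transition_degree U \<phi> \<psi> x = 1)"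
  by (subst orientation_preserving_on_iff_local_degree[OF chart_transition[OF U V]])
    (simp add: transition_degree_def)

lemma transition_degree_constant:
  assumes U: "surface_chart S U \<phi>" and V: "surface_chart S V \<psi>" and conn: "connected (\<phi> ` (U \<inter> V))"
    and xy: "x \<in> U \<inter> V" "y \<in> U \<inter> V"
  shows "transition_degree U \<phi> \<psi> x = transition_degree U \<phi> \<psi> y"
  unfolding transition_degree_def
  by (rule local_degree_constant[OF chart_transition(1)[OF U V] conn chart_transition(2,3)[OF U V]])
    (use xy in auto)

lemma star_chart_triangle:
  assumes L: "is_link \<T> p L" and i: "i < length L"
    and x: "x \<in> std_simplex {p, L ! i, L ! (Suc i mod length L)}"
  shows "star_chart L x = of_real (x (L ! i)) * spoke (length L) i
           + of_real (x (L ! (Suc i mod length L))) * spoke (length L) (Suc i)"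
proof -
  let ?n = "length L"
  have n: "?n \<ge> 3" and dist: "distinct L" and p: "p \<notin> set L" using L by (auto simp: is_link_def)
  have si: "Suc i mod ?n < ?n" using n by (intro mod_less_divisor) linarith
  let ?f = "\<lambda>k. if k < ?n then of_real (x (L ! k)) * spoke ?n k else 0"
  have "?f k = 0" if "k \<noteq> i" "k \<noteq> Suc i mod ?n" for k
    using that x i si p dist
    by (auto simp: std_simplex_def nth_eq_iff_index_eq in_set_conv_nth)
  then have "sum ?f {..<?n} = ?f i + ?f (Suc i mod ?n)" by (rule sum_two_support[OF i n])
  moreover have "spoke ?n (Suc i mod ?n) = spoke ?n (Suc i)" using n by (intro spoke_mod) linarith
  ultimately show ?thesis using i si by (simp add: star_chart_def)
qed

lemma det2_spokes: "det2 (spoke n i) (spoke n (Suc i)) = sin (2 * pi / n)"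
  by (simp only: det2_def Im_cnj_spoke)

lemma next_in_mem: "next_in xs a b \<Longrightarrow> a \<in> set xs \<and> b \<in> set xs"
  unfolding next_in_def by (metis length_greater_0_conv list.size(3) mod_less_divisor not_less_zero nth_mem)

text \<open>On a common triangle \<open>{p, q, r}\<close> the transition is affine, so its degree is the
sign of a determinant. It is positive iff the links of \<open>p\<close> and of
\<open>q\<close> run around the triangle in the same direction.\<close>

lemma transition_degree_in_triangle:
  assumes Lp: "is_link \<T> p Lp" and Lq: "is_link \<T> q Lq" and qr: "next_in Lp q r"
  shows "\<exists>x\<in>star \<T> p \<inter> star \<T> q.
     (next_in Lq r p \<longrightarrow> transition_degree (star \<T> p) (star_chart Lp) (star_chart Lq) x = 1) \<and>
     (next_in Lq p r \<longrightarrow> transition_degree (star \<T> p) (star_chart Lp) (star_chart Lq) x = -1)"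
proof -
  define n m where "n = length Lp" and "m = length Lq"
  have n: "n \<ge> 3" and m: "m \<ge> 3" using Lp Lq by (auto simp: is_link_def n_def m_def)
  obtain i where i: "i < n" and q: "q = Lp ! i" and r: "r = Lp ! (Suc i mod n)"
    using qr by (auto simp: next_in_def n_def)
  have si: "Suc i mod n < n" using n by (intro mod_less_divisor) linarith
  have ii: "i \<noteq> Suc i mod n" using i n by (cases "Suc i = n") auto
  have ne: "p \<noteq> q" "p \<noteq> r" "q \<noteq> r"
    using Lp i si ii by (auto simp: is_link_def q r n_def nth_eq_iff_index_eq)
  have T: "{p, q, r} \<in> \<T>" using Lp qr by (auto simp: is_link_def)
  define u v where "u = spoke n i" and "v = spoke n (Suc i)"
  \<comment> \<open>the point with barycentric coordinates \<open>1 - a - b\<close>, \<open>a\<close>,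
    \<open>b\<close> at \<open>p\<close>, \<open>q\<close>, \<open>r\<close>\<close>
  define X where "X a b = (\<lambda>s. if s = p then 1 - a - b else if s = q then a else if s = r then b else 0)"
    for a b :: real
  have XT: "X a b \<in> std_simplex {p, q, r}" if "0 < a" "0 < b" "a + b < 1" for a b
    using that ne by (auto simp: X_def std_simplex_def)
  have Xp: "X a b p = 1 - a - b" and Xq: "X a b q = a" and Xr: "X a b r = b" for a b
    using ne by (auto simp: X_def)
  have Xstar: "X a b \<in> star \<T> p \<inter> star \<T> q" if "0 < a" "0 < b" "a + b < 1" for a b
    using XT[OF that] T that by (auto simp: star_def realisation_def Xp Xq)
  have chart: "star_chart Lp (X a b) = 0 + of_real a * u + of_real b * v" if "0 < a" "0 < b" "a + b < 1" for a b
    using star_chart_triangle[OF Lp, of i "X a b"] XT[OF that] i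
    by (simp add: Xq Xr u_def v_def flip: n_def q r)
  let ?x = "X (1/3) (1/3)"
  let ?\<tau> = "star_chart Lq \<circ> inv_into (star \<T> p) (star_chart Lp)"
  have \<tau>: "?\<tau> (0 + of_real a * u + of_real b * v) = star_chart Lq (X a b)" if "0 < a" "0 < b" "a + b < 1" for a b
    using chart[OF that] Xstar[OF that] surface_chart_inj[OF surface_chart_star[OF Lp]]
    by (metis IntD1 comp_apply inv_into_f_f)
  define N where "N = {z. 0 < left_coord n i z} \<inter> {z. 0 < right_coord n i z}
    \<inter> {z. left_coord n i z + right_coord n i z < 1}"
  have coords: "left_coord n i (0 + of_real a * u + of_real b * v) = a"
    "right_coord n i (0 + of_real a * u + of_real b * v) = b" for a b
    using sector_coords[OF n, of _ a i b] by (auto simp: u_def v_def)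
  have cont: "continuous_on UNIV (left_coord n i)" "continuous_on UNIV (right_coord n i)"
    unfolding left_coord_def right_coord_def using sin_sector_pos[OF n]
    by (auto intro!: continuous_intros)
  have "open N" unfolding N_def
    by (intro open_Int open_Collect_less continuous_on_const continuous_on_add cont)
  moreover have "star_chart Lp ?x \<in> N"
  proof -
    have "star_chart Lp ?x = 0 + of_real (1/3) * u + of_real (1/3) * v" by (rule chart) auto
    then show ?thesis unfolding N_def by (simp only: Int_iff mem_Collect_eq coords) simp
  qed
  ultimately obtain \<delta> where \<delta>: "0 < \<delta>" "ball (star_chart Lp ?x) \<delta> \<subseteq> N" by (meson open_contains_ball)
  have near: "0 < a \<and> 0 < b \<and> a + b < 1"
    if "0 + of_real a * u + of_real b * v \<in> ball (star_chart Lp ?x) \<delta>" for a b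
  proof -
    have "0 + of_real a * u + of_real b * v \<in> N" using \<delta>(2) that by blast
    then show ?thesis unfolding N_def by (simp only: Int_iff mem_Collect_eq coords)
  qed
  have det: "det2 u v > 0" using sin_sector_pos[OF n] by (simp add: u_def v_def det2_spokes)
  have flip: "det2 (- d) (c - d) = det2 c d" for c d by (simp add: det2_def algebra_simps)
  have flip': "det2 (- c) (d - c) = - det2 c d" for c d by (simp add: det2_def algebra_simps)
  have "transition_degree (star \<T> p) (star_chart Lp) (star_chart Lq) ?x = 1" if nx: "next_in Lq r p"
  proof -
    obtain j where j: "j < m" "r = Lq ! j" "p = Lq ! (Suc j mod m)"
      using nx by (auto simp: next_in_def m_def)
    define c d where "c = spoke m j" and "d = spoke m (Suc j)"
    have form: "?\<tau> (0 + of_real a * u + of_real b * v) = d + of_real a * (- d) + of_real b * (c - d)"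
      if "0 + of_real a * u + of_real b * v \<in> ball (star_chart Lp ?x) \<delta>" for a b
    proof -
      note ab = near[OF that]
      have "star_chart Lq (X a b) = of_real (X a b r) * c + of_real (X a b p) * d"
        unfolding c_def d_def j(2,3) m_def
        by (rule star_chart_triangle[OF Lq]) (use XT[of a b] ab j in \<open>simp_all add: insert_commute m_def\<close>)
      then have "star_chart Lq (X a b) = of_real b * c + of_real (1 - a - b) * d" by (simp only: Xp Xr)
      then show ?thesis using \<tau>[of a b] ab by (simp add: algebra_simps)
    qed
    have "det2 (- d) (c - d) > 0"
      unfolding flip using sin_sector_pos[OF m] by (simp add: c_def d_def det2_spokes)
    with form show ?thesis
      unfolding transition_degree_def by (rule local_degree_affine(1)[OF \<delta>(1) det])
  qed
  moreover have "transition_degree (star \<T> p) (star_chart Lp) (star_chart Lq) ?x = -1" if nx: "next_in Lq p r"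
  proof -
    obtain j where j: "j < m" "p = Lq ! j" "r = Lq ! (Suc j mod m)"
      using nx by (auto simp: next_in_def m_def)
    define c d where "c = spoke m j" and "d = spoke m (Suc j)"
    have form: "?\<tau> (0 + of_real a * u + of_real b * v) = c + of_real a * (- c) + of_real b * (d - c)"
      if "0 + of_real a * u + of_real b * v \<in> ball (star_chart Lp ?x) \<delta>" for a b
    proof -
      note ab = near[OF that]
      have "star_chart Lq (X a b) = of_real (X a b p) * c + of_real (X a b r) * d"
        unfolding c_def d_def j(2,3) m_def
        by (rule star_chart_triangle[OF Lq]) (use XT[of a b] ab j in \<open>simp_all add: insert_commute m_def\<close>)
      then have "star_chart Lq (X a b) = of_real (1 - a - b) * c + of_real b * d" by (simp only: Xp Xr)
      then show ?thesis using \<tau>[of a b] ab by (simp add: algebra_simps)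
    qed
    have "det2 (- c) (d - c) < 0"
      unfolding flip' using sin_sector_pos[OF m] by (simp add: c_def d_def det2_spokes)
    with form show ?thesis
      unfolding transition_degree_def by (rule local_degree_affine(2)[OF \<delta>(1) det])
  qed
  moreover have "?x \<in> star \<T> p \<inter> star \<T> q" by (rule Xstar) auto
  ultimately show ?thesis by blast
qed

lemma connected_star_chart_overlap:
  assumes "\<And>T. T \<in> \<T> \<Longrightarrow> finite T"
  shows "connected (star_chart L ` (star \<T> p \<inter> star \<T> q))"
  by (intro connected_continuous_image continuous_on_star_chart connected_star_Int assms)

text \<open>The sign computed inside one triangle holds on the whole overlap, because overlaps are
connected.\<close>

lemma star_transition_degree:
  assumes fin: "\<And>T. T \<in> \<T> \<Longrightarrow> finite T" and Lp: "is_link \<T> p Lp" and Lq: "is_link \<T> q Lq"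
    and qr: "next_in Lp q r" and x: "x \<in> star \<T> p \<inter> star \<T> q"
  shows "next_in Lq r p \<Longrightarrow> transition_degree (star \<T> p) (star_chart Lp) (star_chart Lq) x = 1"
    and "next_in Lq p r \<Longrightarrow> transition_degree (star \<T> p) (star_chart Lp) (star_chart Lq) x = -1"
proof -
  obtain y where y: "y \<in> star \<T> p \<inter> star \<T> q"
    "next_in Lq r p \<Longrightarrow> transition_degree (star \<T> p) (star_chart Lp) (star_chart Lq) y = 1"
    "next_in Lq p r \<Longrightarrow> transition_degree (star \<T> p) (star_chart Lp) (star_chart Lq) y = -1"
    using transition_degree_in_triangle[OF Lp Lq qr] by blast
  have "transition_degree (star \<T> p) (star_chart Lp) (star_chart Lq) x
      = transition_degree (star \<T> p) (star_chart Lp) (star_chart Lq) y"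
    using transition_degree_constant[OF surface_chart_star[OF Lp] surface_chart_star[OF Lq]
        connected_star_chart_overlap x y(1)] fin by blast
  then show "next_in Lq r p \<Longrightarrow> transition_degree (star \<T> p) (star_chart Lp) (star_chart Lq) x = 1"
    and "next_in Lq p r \<Longrightarrow> transition_degree (star \<T> p) (star_chart Lp) (star_chart Lq) x = -1"
    using y by simp_all
qed

lemma star_Int_neighbour:
  assumes L: "is_link \<T> p L" and x: "x \<in> star \<T> p \<inter> star \<T> q" and ne: "q \<noteq> p"
  obtains r where "next_in L q r"
proof -
  have "q \<in> set L"
  proof (rule ccontr)
    assume "q \<notin> set L"
    then have "x q = 0" using star_chart_coords(3)[OF L _ ne] x by simp
    then show False using x by (simp add: star_def)
  qed
  then show ?thesis using that by (auto simp: next_in_def in_set_conv_nth)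
qed

text \<open>If all links run around their triangles coherently, then the star charts form an oriented
atlas.\<close>

theorem orientable_realisation:
  assumes fin: "\<And>T. T \<in> \<T> \<Longrightarrow> finite T"
    and links: "\<And>p. p \<in> \<Union>\<T> \<Longrightarrow> is_link \<T> p (L p)"
    and coherent: "\<And>p q r. p \<in> \<Union>\<T> \<Longrightarrow> next_in (L p) q r \<Longrightarrow> next_in (L q) r p"
  shows "orientable_surface (realisation \<T>)"
proof -
  let ?\<A> = "(\<lambda>p. (star \<T> p, star_chart (L p))) ` \<Union>\<T>"
  have "orientation_preserving_on (star_chart (L p) ` (star \<T> p \<inter> star \<T> q))
      (star_chart (L q) \<circ> inv_into (star \<T> p) (star_chart (L p)))"
    if pq: "p \<in> \<Union>\<T>" "q \<in> \<Union>\<T>" for p q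
    unfolding orientation_preserving_transition_iff[OF surface_chart_star[OF links[OF pq(1)]]
        surface_chart_star[OF links[OF pq(2)]]]
  proof
    fix x assume x: "x \<in> star \<T> p \<inter> star \<T> q"
    show "transition_degree (star \<T> p) (star_chart (L p)) (star_chart (L q)) x = 1"
    proof (cases "q = p")
      case True
      then show ?thesis using transition_degree_self[OF surface_chart_star[OF links[OF pq(1)]]] x by simp
    next
      case False
      then obtain r where r: "next_in (L p) q r" using star_Int_neighbour[OF links[OF pq(1)] x] by metis
      then show ?thesis
        using star_transition_degree(1)[OF fin links[OF pq(1)] links[OF pq(2)] r x] coherent pq by blast
    qed
  qed
  moreover have "realisation \<T> = (\<Union>p\<in>\<Union>\<T>. star \<T> p)"
  proof (intro equalityI subsetI)
    fix x assume "x \<in> realisation \<T>"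
    then obtain p where "p \<in> \<Union>\<T>" "x \<in> star \<T> p" by (rule realisation_covered)
    then show "x \<in> (\<Union>p\<in>\<Union>\<T>. star \<T> p)" by blast
  qed (auto simp: star_def)
  moreover have "surface_chart (realisation \<T>) (star \<T> p) (star_chart (L p))" if "p \<in> \<Union>\<T>" for p
    using surface_chart_star[OF links[OF that]] .
  ultimately show ?thesis
    unfolding orientable_surface_def by (intro exI[of _ ?\<A>]) auto
qed

text \<open>Conversely, an oriented atlas assigns a sign to every vertex: the common degree of the
changes from its star chart to the charts of the atlas. Neighbours have equal signs iff
their links are coherent. An inconsistent cycle of such conditions is therefore an
obstruction to orientability.\<close>

theorem orientable_realisation_signs:
  assumes fin: "\<And>T. T \<in> \<T> \<Longrightarrow> finite T"
    and links: "\<And>p. p \<in> \<Union>\<T> \<Longrightarrow> is_link \<T> p (L p)"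
    and ori: "orientable_surface (realisation \<T>)"
  shows "\<exists>\<epsilon> :: 'p \<Rightarrow> complex. (\<forall>p\<in>\<Union>\<T>. \<epsilon> p \<noteq> 0) \<and>
    (\<forall>p\<in>\<Union>\<T>. \<forall>q\<in>\<Union>\<T>. \<forall>r. next_in (L p) q r \<longrightarrow>
       (next_in (L q) r p \<longrightarrow> \<epsilon> p = \<epsilon> q) \<and> (next_in (L q) p r \<longrightarrow> \<epsilon> p = - \<epsilon> q))"
proof -
  let ?S = "realisation \<T>"
  obtain \<A> where \<A>: "(\<forall>(U, \<phi>)\<in>\<A>. surface_chart ?S U \<phi>) \<and> ?S = (\<Union>(U, \<phi>)\<in>\<A>. U) \<and>
      (\<forall>(U, \<phi>)\<in>\<A>. \<forall>(V, \<psi>)\<in>\<A>.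
         orientation_preserving_on (\<phi> ` (U \<inter> V)) (\<psi> \<circ> inv_into U \<phi>))"
    using ori unfolding orientable_surface_def by (rule exE)
  have charts: "surface_chart ?S U \<phi>" if "(U, \<phi>) \<in> \<A>" for U \<phi>
    using bspec[OF conjunct1[OF \<A>] that] by simp
  have pres: "orientation_preserving_on (\<phi> ` (U \<inter> V)) (\<psi> \<circ> inv_into U \<phi>)"
    if "(U, \<phi>) \<in> \<A>" "(V, \<psi>) \<in> \<A>" for U \<phi> V \<psi>
    using bspec[OF conjunct2[OF conjunct2[OF \<A>]] that(1)] that(2) by auto
  have cover: "?S = (\<Union>(U, \<phi>)\<in>\<A>. U)" using \<A> by (elim conjE)
  have one: "transition_degree U \<phi> \<psi> x = 1" if "(U, \<phi>) \<in> \<A>" "(V, \<psi>) \<in> \<A>" "x \<in> U" "x \<in> V" for U \<phi> V \<psi> x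
    using pres[OF that(1,2)] that
      orientation_preserving_transition_iff[OF charts[OF that(1)] charts[OF that(2)]] by blast
  define chart_at where "chart_at x = (SOME c. c \<in> \<A> \<and> x \<in> fst c)" for x
  have chart_at: "(fst (chart_at x), snd (chart_at x)) \<in> \<A>" "x \<in> fst (chart_at x)" if "x \<in> ?S" for x
  proof -
    have "\<exists>c. c \<in> \<A> \<and> x \<in> fst c" using that cover by force
    from someI_ex[OF this]
    show "(fst (chart_at x), snd (chart_at x)) \<in> \<A>" "x \<in> fst (chart_at x)" by (auto simp: chart_at_def)
  qed
  \<comment> \<open>the comparison of the star chart of \<open>p\<close> with the oriented atlas at
    \<open>x\<close>\<close>
  define sg where "sg p x = transition_degree (star \<T> p) (star_chart (L p)) (snd (chart_at x)) x" for p x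
  have sub: "star \<T> p \<subseteq> ?S" for p by (auto simp: star_def)
  note sc = surface_chart_star[OF links]
  \<comment> \<open>independence of the chosen chart, as the charts of the atlas agree in orientation\<close>
  have sg_eq: "sg p x = transition_degree (star \<T> p) (star_chart (L p)) \<psi> x"
    if p: "p \<in> \<Union>\<T>" and x: "x \<in> star \<T> p" and V: "(V, \<psi>) \<in> \<A>" "x \<in> V" for p x V \<psi>
  proof -
    have xS: "x \<in> ?S" using x sub by blast
    have "transition_degree (star \<T> p) (star_chart (L p)) \<psi> x
       = transition_degree (fst (chart_at x)) (snd (chart_at x)) \<psi> x
         * transition_degree (star \<T> p) (star_chart (L p)) (snd (chart_at x)) x"
      by (rule transition_degree_cocycle[OF sc[OF p] charts[OF chart_at(1)[OF xS]]
            charts[OF V(1)] x chart_at(2)[OF xS] V(2)])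
    then show ?thesis using one[OF chart_at(1)[OF xS] V(1) chart_at(2)[OF xS] V(2)] by (simp add: sg_def)
  qed
  have sg_const: "sg p x = sg p y" if p: "p \<in> \<Union>\<T>" and xy: "x \<in> star \<T> p" "y \<in> star \<T> p" for p x y
  proof -
    let ?U = "star \<T> p" and ?\<phi> = "star_chart (L p)"
    let ?g = "inv_into ?U ?\<phi>"
    have inv: "?g (?\<phi> x) = x" if "x \<in> ?U" for x
      using surface_chart_inj[OF sc[OF p]] that by (rule inv_into_f_f)
    have "connected (?\<phi> ` ?U)"
      using connected_star_chart_overlap[of \<T> "L p" p p] fin by simp
    moreover have "\<forall>z\<in>?\<phi> ` ?U. \<forall>\<^sub>F w in at z within (?\<phi> ` ?U). sg p (?g z) = sg p (?g w)"
    proof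
      fix z assume "z \<in> ?\<phi> ` ?U"
      then obtain a where a: "a \<in> ?U" "z = ?\<phi> a" by blast
      define V \<psi> where "V = fst (chart_at a)" and "\<psi> = snd (chart_at a)"
      have V: "(V, \<psi>) \<in> \<A>" "a \<in> V" using chart_at[of a] a(1) sub by (auto simp: V_def \<psi>_def)
      note tr = chart_transition[OF sc[OF p] charts[OF V(1)]]
      have "z \<in> ?\<phi> ` (?U \<inter> V)" using a V by auto
      then obtain \<delta> where \<delta>: "0 < \<delta>" "ball z \<delta> \<subseteq> ?\<phi> ` (?U \<inter> V)" using tr(1) by (meson open_contains_ball)
      have val: "sg p (?g w) = local_degree (\<psi> \<circ> ?g) w" if w: "w \<in> ball z \<delta>" for w
      proof -
        obtain b where b: "b \<in> ?U" "b \<in> V" "w = ?\<phi> b" using w \<delta>(2) by blast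
        then show ?thesis using sg_eq[OF p b(1) V(1) b(2)] by (simp add: inv transition_degree_def)
      qed
      have "sg p (?g z) = sg p (?g w)" if w: "w \<in> ball z \<delta>" for w
      proof -
        have "local_degree (\<psi> \<circ> ?g) z = local_degree (\<psi> \<circ> ?g) w"
          using \<delta> w by (intro local_degree_constant[OF open_ball connected_ball
                continuous_on_subset[OF tr(2)] inj_on_subset[OF tr(3)]]) auto
        then show ?thesis using val w \<delta>(1) by simp
      qed
      then show "\<forall>\<^sub>F w in at z within (?\<phi> ` ?U). sg p (?g z) = sg p (?g w)"
        using \<delta>(1) by (auto simp: eventually_at dist_commute intro!: exI[of _ \<delta>])
    qed
    ultimately have "sg p (?g (?\<phi> x)) = sg p (?g (?\<phi> y))"
      using xy by (intro connected_local_const[where f = "\<lambda>z. sg p (?g z)"]) auto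
    then show ?thesis using inv xy by simp
  qed
  define \<epsilon> where "\<epsilon> p = sg p (midpoint_of p p)" for p
  have mid: "midpoint_of p p \<in> star \<T> p" if p: "p \<in> \<Union>\<T>" for p
  proof -
    obtain T where "T \<in> \<T>" "p \<in> T" using p by blast
    then show ?thesis using midpoint_in_simplex[of T p p] fin
      by (auto simp: star_def realisation_def midpoint_of_def)
  qed
  have step: "\<epsilon> p = \<epsilon> q * d"
    if pq: "p \<in> \<Union>\<T>" "q \<in> \<Union>\<T>" and nx: "next_in (L p) q r"
      and d: "\<And>x. x \<in> star \<T> p \<inter> star \<T> q \<Longrightarrow>
        transition_degree (star \<T> p) (star_chart (L p)) (star_chart (L q)) x = d"
    for p q r d
  proof -
    obtain x where x: "x \<in> star \<T> p" "x \<in> star \<T> q"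
      using transition_degree_in_triangle[OF links[OF pq(1)] links[OF pq(2)] nx] by blast
    then have xS: "x \<in> ?S" using sub by blast
    have "sg p x = sg q x * d"
      using transition_degree_cocycle[OF sc[OF pq(1)] sc[OF pq(2)] charts[OF chart_at(1)[OF xS]]
          x chart_at(2)[OF xS]] d x
      by (simp add: sg_def)
    then show ?thesis
      using sg_const[OF pq(1) x(1) mid[OF pq(1)]] sg_const[OF pq(2) x(2) mid[OF pq(2)]] by (simp add: \<epsilon>_def)
  qed
  have "\<epsilon> p \<noteq> 0" if p: "p \<in> \<Union>\<T>" for p
  proof -
    have xS: "midpoint_of p p \<in> ?S" using mid[OF p] sub by blast
    have "\<epsilon> p = 1 \<or> \<epsilon> p = -1"
      unfolding \<epsilon>_def sg_def
      using mid[OF p] chart_at(2)[OF xS]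
      by (intro transition_degree_cases[OF sc[OF p] charts[OF chart_at(1)[OF xS]]]) blast
    then show ?thesis by auto
  qed
  moreover have "\<epsilon> p = \<epsilon> q"
    if pq: "p \<in> \<Union>\<T>" "q \<in> \<Union>\<T>" and nx: "next_in (L p) q r" and co: "next_in (L q) r p" for p q r
    using step[OF pq nx, of 1] star_transition_degree(1)[OF fin links[OF pq(1)] links[OF pq(2)] nx _ co] by simp
  moreover have "\<epsilon> p = - \<epsilon> q"
    if pq: "p \<in> \<Union>\<T>" "q \<in> \<Union>\<T>" and nx: "next_in (L p) q r" and co: "next_in (L q) p r" for p q r
    using step[OF pq nx, of "-1"] star_transition_degree(2)[OF fin links[OF pq(1)] links[OF pq(2)] nx _ co] by simp
  ultimately show ?thesis by blast
qed

section \<open>Maps given by lists of faces\<close>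

definition arcs :: "'a list \<Rightarrow> ('a \<times> 'a) list" where
  "arcs xs = zip xs (rotate1 xs)"

lemma arcs_iff: "(a, b) \<in> set (arcs xs) \<longleftrightarrow> next_in xs a b"
  by (auto simp: arcs_def next_in_def set_zip nth_rotate1)

lemma cyc_altdef: "cyc xs = {{a, b} | a b. next_in xs a b}"
  by (auto simp: cyc_def next_in_def)

lemma Union_cyc: "\<Union> (cyc xs) = set xs"
proof
  show "\<Union> (cyc xs) \<subseteq> set xs" by (auto simp: cyc_altdef dest: next_in_mem)
  show "set xs \<subseteq> \<Union> (cyc xs)"
  proof
    fix v assume "v \<in> set xs"
    then have "\<exists>b. next_in xs v b" by (auto simp: in_set_conv_nth next_in_def)
    then show "v \<in> \<Union> (cyc xs)" by (auto simp: cyc_altdef)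
  qed
qed

lemma next_in_map: "next_in (map f xs) a b \<longleftrightarrow> (\<exists>a' b'. next_in xs a' b' \<and> a = f a' \<and> b = f b')"
proof -
  have "map f xs ! (Suc i mod length xs) = f (xs ! (Suc i mod length xs))" if "i < length xs" for i
    using that by (intro nth_map mod_less_divisor) linarith
  then show ?thesis unfolding next_in_def by fastforce
qed

text \<open>Links are transported by a renaming of the points. This allows the links to be checked on a
triangulation whose points are numbers.\<close>

lemma is_link_image:
  assumes inj: "inj_on f (\<Union>\<T>)" and L: "is_link \<T> p L" and p: "p \<in> \<Union>\<T>"
  shows "is_link ((`) f ` \<T>) (f p) (map f L)"
proof -
  have mem: "{p, a, b} \<in> \<T>" if "next_in L a b" for a b using L that by (auto simp: is_link_def)
  have sub: "set L \<subseteq> \<Union>\<T>"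
  proof
    fix q assume "q \<in> set L"
    then obtain b where "next_in L q b" by (auto simp: in_set_conv_nth next_in_def)
    then show "q \<in> \<Union>\<T>" using mem by blast
  qed
  show ?thesis unfolding is_link_def
  proof (intro conjI allI)
    show "distinct (map f L)"
      using L sub inj by (auto simp: is_link_def distinct_map intro: inj_on_subset)
    show "3 \<le> length (map f L)" using L by (simp add: is_link_def)
    show "f p \<notin> set (map f L)"
    proof
      assume "f p \<in> set (map f L)"
      then obtain q where "q \<in> set L" "f p = f q" by auto
      then have "p \<in> set L" using inj p sub by (metis inj_onD subsetD)
      then show False using L by (simp add: is_link_def)
    qed
    fix T'
    have "T' \<in> (`) f ` \<T> \<and> f p \<in> T' \<longleftrightarrow> (\<exists>T. T \<in> \<T> \<and> p \<in> T \<and> T' = f ` T)"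
    proof
      assume "T' \<in> (`) f ` \<T> \<and> f p \<in> T'"
      then obtain T q where T: "T \<in> \<T>" "T' = f ` T" "q \<in> T" "f p = f q" by auto
      then have "p = q" using inj p by (metis UnionI inj_onD)
      then show "\<exists>T. T \<in> \<T> \<and> p \<in> T \<and> T' = f ` T" using T by blast
    qed auto
    also have "\<dots> \<longleftrightarrow> (\<exists>a b. next_in L a b \<and> T' = f ` {p, a, b})"
      using L unfolding is_link_def by metis
    also have "\<dots> \<longleftrightarrow> (\<exists>a b. next_in (map f L) a b \<and> T' = {f p, a, b})"
      by (auto simp: next_in_map)
    finally show "T' \<in> (`) f ` \<T> \<and> f p \<in> T' \<longleftrightarrow> (\<exists>a b. next_in (map f L) a b \<and> T' = {f p, a, b})" .
  qed
qed

text \<open>The numbers below \<open>n\<close> stand for the vertices of the map, and \<open>n +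
j\<close> stands for the apex of the cone over the \<open>j\<close>-th face.\<close>

definition point_of :: "nat \<Rightarrow> 'a list list \<Rightarrow> nat \<Rightarrow> nat + 'a set set" where
  "point_of n fs k = (if k < n then Inl k else Inr (cyc (fs ! (k - n))))"

definition cone_triangles :: "nat \<Rightarrow> nat list list \<Rightarrow> nat list list" where
  "cone_triangles n fs =
     concat (map (\<lambda>j. map (\<lambda>(a, b). sort [a, b, n + j]) (arcs (fs ! j))) [0..<length fs])"

text \<open>Distinctness of the sorted lists says that different faces have different vertex sets, so
that distinct numbers stand for distinct points.\<close>

definition polygon_lists :: "nat \<Rightarrow> nat list list \<Rightarrow> bool" where
  "polygon_lists n fs \<longleftrightarrow>
     (\<forall>xs\<in>set fs. distinct xs \<and> 3 \<le> length xs \<and> (\<forall>v\<in>set xs. v < n)) \<and>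
     distinct (map sort fs)"

lemma in_cone_triangles:
  "t \<in> set (cone_triangles n fs) \<longleftrightarrow> (\<exists>j a b. j < length fs \<and> next_in (fs ! j) a b \<and> t = sort [a, b, n + j])"
proof -
  have "set (cone_triangles n fs) = (\<Union>j\<in>{..<length fs}. (\<lambda>(a, b). sort [a, b, n + j]) ` set (arcs (fs ! j)))"
    unfolding cone_triangles_def by (simp del: sort_key_simps add: atLeast0LessThan)
  then have "t \<in> set (cone_triangles n fs) \<longleftrightarrow>
      (\<exists>j\<in>{..<length fs}. \<exists>c\<in>set (arcs (fs ! j)). t = (case c of (a, b) \<Rightarrow> sort [a, b, n + j]))"
    by blast
  also have "\<dots> \<longleftrightarrow> (\<exists>j a b. j < length fs \<and> (a, b) \<in> set (arcs (fs ! j)) \<and> t = sort [a, b, n + j])"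
    unfolding Bex_def split_paired_Ex lessThan_iff prod.case by blast
  finally show ?thesis unfolding arcs_iff .
qed

lemma set_cone_triangles:
  "set ` set (cone_triangles n fs) = {{a, b, n + j} | a b j. j < length fs \<and> next_in (fs ! j) a b}"
proof -
  have "T \<in> set ` set (cone_triangles n fs) \<longleftrightarrow>
      (\<exists>j a b. j < length fs \<and> next_in (fs ! j) a b \<and> T = set (sort [a, b, n + j]))" for T
    unfolding image_iff Bex_def in_cone_triangles by blast
  moreover have "set (sort [a, b, c]) = {a, b, c}" for a b c :: nat by (simp only: set_sort list.set)
  ultimately show ?thesis by (simp only: set_eq_iff) blast
qed

lemma point_of_inj:
  assumes fs: "polygon_lists n fs"
  shows "inj_on (point_of n fs) {..<n + length fs}"
proof (rule inj_onI)
  fix k l assume kl: "k \<in> {..<n + length fs}" "l \<in> {..<n + length fs}" and eq: "point_of n fs k = point_of n fs l"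
  show "k = l"
  proof (cases "k < n")
    case True then show ?thesis using eq by (auto simp: point_of_def split: if_split_asm)
  next
    case False
    then have l: "\<not> l < n" and c: "cyc (fs ! (k - n)) = cyc (fs ! (l - n))"
      using eq by (auto simp: point_of_def split: if_split_asm)
    have k': "k - n < length fs" "l - n < length fs" using kl False l by auto
    have "set (fs ! (k - n)) = set (fs ! (l - n))" using c by (metis Union_cyc)
    moreover have "distinct (fs ! (k - n))" "distinct (fs ! (l - n))"
      using fs k' by (auto simp: polygon_lists_def)
    ultimately have "sort (fs ! (k - n)) = sort (fs ! (l - n))"
      by (intro sorted_distinct_set_unique) auto
    then have "map sort fs ! (k - n) = map sort fs ! (l - n)" using k' by simp
    then have "k - n = l - n"
      using fs k' nth_eq_iff_index_eq[of "map sort fs" "k - n" "l - n"] by (simp add: polygon_lists_def)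
    then show ?thesis using False l by linarith
  qed
qed

text \<open>The carrier of a map is the realisation of the triangulation that subdivides every face by
the cone from an interior point.\<close>

lemma geometric_carrier_eq_realisation:
  assumes fs: "polygon_lists n fs"
  shows "geometric_carrier (cyc ` set fs)
    = realisation ((`) (point_of n fs) ` set ` set (cone_triangles n fs))"
proof -
  have ft: "face_triangle F e = std_simplex (insert (Inr F) (Inl ` e))" for F :: "nat set set" and e
    by (simp add: face_triangle_def std_simplex_def)
  have pt: "point_of n fs ` {a, b, n + j} = insert (Inr (cyc (fs ! j))) (Inl ` {a, b})"
    if "j < length fs" "next_in (fs ! j) a b" for a b j
  proof -
    have "a < n" "b < n" using next_in_mem[OF that(2)] that(1) fs by (auto simp: polygon_lists_def)
    then show ?thesis by (auto simp: point_of_def)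
  qed
  have edges: "(\<exists>e\<in>cyc xs. P e) \<longleftrightarrow> (\<exists>a b. next_in xs a b \<and> P {a, b})" for xs :: "nat list" and P
    by (auto simp: cyc_altdef)
  have "x \<in> geometric_carrier (cyc ` set fs) \<longleftrightarrow> x \<in> realisation ((`) (point_of n fs) ` set ` set (cone_triangles n fs))" for x
  proof -
    have "x \<in> geometric_carrier (cyc ` set fs) \<longleftrightarrow>
        (\<exists>xs\<in>set fs. \<exists>a b. next_in xs a b \<and> x \<in> std_simplex (insert (Inr (cyc xs)) (Inl ` {a, b})))"
      by (simp only: geometric_carrier_def ft UN_iff bex_simps edges)
    also have "\<dots> \<longleftrightarrow> (\<exists>j a b. j < length fs \<and> next_in (fs ! j) a b \<and>
        x \<in> std_simplex (insert (Inr (cyc (fs ! j))) (Inl ` {a, b})))"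
      by (simp only: Bex_def in_set_conv_nth) blast
    also have "\<dots> \<longleftrightarrow> (\<exists>j a b. j < length fs \<and> next_in (fs ! j) a b \<and> x \<in> std_simplex (point_of n fs ` {a, b, n + j}))"
      using pt by (intro iff_exI) (auto simp del: image_insert)
    also have "\<dots> \<longleftrightarrow> x \<in> realisation ((`) (point_of n fs) ` set ` set (cone_triangles n fs))"
      unfolding realisation_def set_cone_triangles by blast
    finally show ?thesis .
  qed
  then show ?thesis by blast
qed

text \<open>Triangles are represented by sorted lists, so that comparing finite sets of triangles is
comparing lists.\<close>

definition check_link :: "nat list list \<Rightarrow> nat \<Rightarrow> nat list \<Rightarrow> bool" where
  "check_link ts p L \<longleftrightarrow> distinct L \<and> 3 \<le> length L \<and> p \<notin> set L \<and>
     set (map (\<lambda>(a, b). sort [p, a, b]) (arcs L)) = set (filter (\<lambda>t. p \<in> set t) ts)"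

lemma check_link_sound:
  assumes L: "check_link ts p L" and ts: "\<And>t. t \<in> set ts \<Longrightarrow> sorted t \<and> distinct t"
  shows "is_link (set ` set ts) p L"
proof -
  have eq: "(\<lambda>(a, b). sort [p, a, b]) ` set (arcs L) = {t \<in> set ts. p \<in> set t}"
    using L by (simp add: check_link_def)
  have "T \<in> set ` set ts \<and> p \<in> T \<longleftrightarrow> (\<exists>a b. next_in L a b \<and> T = {p, a, b})" for T
  proof -
    have "T \<in> set ` set ts \<and> p \<in> T \<longleftrightarrow> T \<in> set ` {t \<in> set ts. p \<in> set t}" by auto
    also have "\<dots> \<longleftrightarrow> T \<in> set ` (\<lambda>(a, b). sort [p, a, b]) ` set (arcs L)" by (simp only: eq)
    also have "\<dots> \<longleftrightarrow> (\<exists>c\<in>set (arcs L). T = set (case c of (a, b) \<Rightarrow> sort [p, a, b]))" by blast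
    also have "\<dots> \<longleftrightarrow> (\<exists>a b. next_in L a b \<and> T = {p, a, b})"
      unfolding Bex_def split_paired_Ex prod.case arcs_iff set_sort list.set by blast
    finally show ?thesis .
  qed
  then show ?thesis using L unfolding is_link_def check_link_def by blast
qed

definition check_links :: "nat list list \<Rightarrow> nat list list \<Rightarrow> bool" where
  "check_links ts Ls \<longleftrightarrow> (\<forall>p\<in>set [0..<length Ls]. check_link ts p (Ls ! p))"

text \<open>Every point is joined by an edge to a point with a smaller number. This is a simple
certificate for connectedness that only depends on the numbering.\<close>

definition check_reachable :: "nat list list \<Rightarrow> nat \<Rightarrow> bool" where
  "check_reachable ts N \<longleftrightarrow> (\<forall>p\<in>set [1..<N]. \<exists>t\<in>set ts. p \<in> set t \<and> (\<exists>q\<in>set t. q < p))"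

definition check_polygon_pair :: "nat list \<Rightarrow> nat list \<Rightarrow> bool" where
  "check_polygon_pair xs ys \<longleftrightarrow> xs = ys \<or>
     (case filter (\<lambda>v. v \<in> set ys) xs of [] \<Rightarrow> True | [_] \<Rightarrow> True
      | [a, b] \<Rightarrow> ((a, b) \<in> set (arcs xs) \<or> (b, a) \<in> set (arcs xs)) \<and> ((a, b) \<in> set (arcs ys) \<or> (b, a) \<in> set (arcs ys))
      | _ \<Rightarrow> False)"

text \<open>The list \<open>vls\<close> holds the links of the vertices in the triangulation by cones.
The link of an apex is the boundary of its face, so the list of all links is \<open>vls @
fs\<close>.\<close>

definition check_map :: "nat list list \<Rightarrow> nat list list \<Rightarrow> bool" where
  "check_map fs vls \<longleftrightarrow> vls \<noteq> [] \<and> polygon_lists (length vls) fs \<and>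
     (\<forall>xs\<in>set fs. \<forall>ys\<in>set fs. check_polygon_pair xs ys) \<and>
     check_links (cone_triangles (length vls) fs) (vls @ fs) \<and>
     check_reachable (cone_triangles (length vls) fs) (length vls + length fs)"

definition coherent_at :: "nat list list \<Rightarrow> nat \<Rightarrow> nat \<Rightarrow> bool" where
  "coherent_at Ls p q \<longleftrightarrow> (\<exists>(x, r)\<in>set (arcs (Ls ! p)). x = q \<and> (r, p) \<in> set (arcs (Ls ! q)))"

definition reversed_at :: "nat list list \<Rightarrow> nat \<Rightarrow> nat \<Rightarrow> bool" where
  "reversed_at Ls p q \<longleftrightarrow> (\<exists>(x, r)\<in>set (arcs (Ls ! p)). x = q \<and> (p, r) \<in> set (arcs (Ls ! q)))"

definition check_coherent :: "nat list list \<Rightarrow> bool" where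
  "check_coherent Ls \<longleftrightarrow>
     (\<forall>p\<in>set [0..<length Ls]. \<forall>(q, r)\<in>set (arcs (Ls ! p)). (r, p) \<in> set (arcs (Ls ! q)))"

lemma edge_in_cyc: "{a, b} \<in> cyc xs \<longleftrightarrow> (a, b) \<in> set (arcs xs) \<or> (b, a) \<in> set (arcs xs)"
  by (auto simp: cyc_altdef arcs_iff doubleton_eq_iff)

lemma check_polygon_pair_sound:
  assumes "check_polygon_pair xs ys" "xs \<noteq> ys"
  shows "set xs \<inter> set ys = {} \<or> (\<exists>v. set xs \<inter> set ys = {v}) \<or> set xs \<inter> set ys \<in> cyc xs \<inter> cyc ys"
proof -
  define common where "common = filter (\<lambda>v. v \<in> set ys) xs"
  have eq: "set xs \<inter> set ys = set common" by (auto simp: common_def)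
  consider "common = []" | v where "common = [v]" | a b where "common = [a, b]" "{a, b} \<in> cyc xs" "{a, b} \<in> cyc ys"
    using assms unfolding check_polygon_pair_def edge_in_cyc common_def[symmetric]
    by (auto split: list.split_asm)
  then show ?thesis unfolding eq by cases auto
qed

lemma polyhedral_complex_of_lists:
  assumes "polygon_lists n fs" "\<forall>xs\<in>set fs. \<forall>ys\<in>set fs. check_polygon_pair xs ys"
  shows "polyhedral_complex (cyc ` set fs)"
  unfolding polyhedral_complex_def
proof (intro conjI ballI impI)
  fix F G assume FG: "F \<in> cyc ` set fs" "G \<in> cyc ` set fs" "F \<noteq> G"
  then obtain xs ys where xs: "xs \<in> set fs" "F = cyc xs" and ys: "ys \<in> set fs" "G = cyc ys" by blast
  then show "\<Union> F \<inter> \<Union> G = {} \<or> (\<exists>v. \<Union> F \<inter> \<Union> G = {v}) \<or> \<Union> F \<inter> \<Union> G \<in> F \<inter> G"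
    using check_polygon_pair_sound[of xs ys] assms(2) FG(3) by (auto simp: Union_cyc)
qed (use assms(1) in \<open>auto simp: polygon_lists_def\<close>)

lemma sorted_distinct_cone_triangles:
  assumes fs: "polygon_lists n fs" and t: "t \<in> set (cone_triangles n fs)"
  shows "sorted t \<and> distinct t"
proof -
  obtain j a b where j: "j < length fs" "next_in (fs ! j) a b" "t = sort [a, b, n + j]"
    using t unfolding in_cone_triangles by blast
  have d: "distinct (fs ! j)" "3 \<le> length (fs ! j)" using fs j(1) by (auto simp: polygon_lists_def)
  obtain i where i: "i < length (fs ! j)" "a = fs ! j ! i" "b = fs ! j ! (Suc i mod length (fs ! j))"
    using j(2) by (auto simp: next_in_def)
  have "i \<noteq> Suc i mod length (fs ! j)" using i d by (cases "Suc i = length (fs ! j)") auto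
  moreover have "Suc i mod length (fs ! j) < length (fs ! j)" using d(2) by (intro mod_less_divisor) linarith
  ultimately have "a \<noteq> b" using i d(1) by (simp add: nth_eq_iff_index_eq)
  moreover have "a < n" "b < n" using next_in_mem[OF j(2)] fs j(1) by (auto simp: polygon_lists_def)
  ultimately have "distinct [a, b, n + j]" by auto
  then show ?thesis unfolding j(3) by (simp only: sorted_sort distinct_sort)
qed

locale checked_map =
  fixes fs vls :: "nat list list"
  assumes check: "check_map fs vls"
begin

abbreviation "n \<equiv> length vls"
abbreviation "N \<equiv> n + length fs"
abbreviation "Ls \<equiv> vls @ fs"
abbreviation "pt \<equiv> point_of n fs"
abbreviation "codes \<equiv> set ` set (cone_triangles n fs)"
abbreviation "triangles \<equiv> (`) pt ` codes"
abbreviation "code \<equiv> inv_into {..<N} pt"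
definition "links q = map pt (Ls ! code q)"

lemma lists: "polygon_lists n fs" using check by (simp add: check_map_def)

lemma link_code: "p < N \<Longrightarrow> is_link codes p (Ls ! p)"
  using check sorted_distinct_cone_triangles[OF lists]
  by (intro check_link_sound) (auto simp: check_map_def check_links_def)

lemma Union_codes: "\<Union>codes = {..<N}"
proof
  show "\<Union>codes \<subseteq> {..<N}"
    unfolding set_cone_triangles using lists next_in_mem by (fastforce simp: polygon_lists_def)
  show "{..<N} \<subseteq> \<Union>codes"
  proof
    fix p assume "p \<in> {..<N}"
    then have L: "is_link codes p (Ls ! p)" using link_code by simp
    then have "0 < length (Ls ! p)" by (auto simp: is_link_def)
    then have "\<exists>a b. next_in (Ls ! p) a b" unfolding next_in_def by blast
    then show "p \<in> \<Union>codes" using L unfolding is_link_def by blast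
  qed
qed

lemma inj: "inj_on pt (\<Union>codes)"
  unfolding Union_codes by (rule point_of_inj[OF lists])

lemma code_pt: "p < N \<Longrightarrow> code (pt p) = p"
  using inj unfolding Union_codes by (intro inv_into_f_f) auto

lemma Union_triangles: "\<Union>triangles = pt ` {..<N}"
  unfolding Union_codes[symmetric] by blast

lemma link: "q \<in> \<Union>triangles \<Longrightarrow> is_link triangles q (links q)"
proof -
  assume "q \<in> \<Union>triangles"
  then obtain p where p: "p < N" "q = pt p" unfolding Union_triangles by blast
  have "is_link triangles (pt p) (map pt (Ls ! p))"
    using p by (intro is_link_image inj link_code) (auto simp: Union_codes)
  then show ?thesis using p by (simp add: links_def code_pt)
qed

lemma finite_triangle: "T \<in> triangles \<Longrightarrow> finite T"
  by auto

lemma carrier: "geometric_carrier (cyc ` set fs) = realisation triangles"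
  by (rule geometric_carrier_eq_realisation[OF lists])

lemma reachable: "p < N \<Longrightarrow> (pt 0, pt p) \<in> {(a, b). \<exists>T\<in>triangles. a \<in> T \<and> b \<in> T}\<^sup>*"
proof (induction p rule: less_induct)
  case (less p)
  show ?case
  proof (cases "p = 0")
    case False
    then have "p \<in> set [1..<N]" using less.prems by simp
    moreover have "check_reachable (cone_triangles n fs) N" using check by (simp add: check_map_def)
    ultimately obtain t q where t: "t \<in> set (cone_triangles n fs)" "p \<in> set t" "q \<in> set t" "q < p"
      unfolding check_reachable_def by blast
    have "(pt 0, pt q) \<in> {(a, b). \<exists>T\<in>triangles. a \<in> T \<and> b \<in> T}\<^sup>*"
      using less t(4) by simp
    moreover have "(pt q, pt p) \<in> {(a, b). \<exists>T\<in>triangles. a \<in> T \<and> b \<in> T}" using t by blast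
    ultimately show ?thesis by (rule rtrancl_into_rtrancl)
  qed simp
qed

lemma polyhedral: "polyhedral_map (cyc ` set fs)"
  unfolding polyhedral_map_def
proof
  show "polyhedral_complex (cyc ` set fs)"
    using check by (intro polyhedral_complex_of_lists[OF lists]) (simp add: check_map_def)
  have "0 < N" using check by (simp add: check_map_def)
  then have "pt 0 \<in> \<Union>triangles" unfolding Union_triangles by blast
  then show "closed_surface (geometric_carrier (cyc ` set fs))"
    unfolding carrier
  proof (intro closed_surface_realisation[where L = links and c = "pt 0"])
    show "(pt 0, q) \<in> {(a, b). \<exists>T\<in>triangles. a \<in> T \<and> b \<in> T}\<^sup>*" if "q \<in> \<Union>triangles" for q
      using that reachable unfolding Union_triangles by blast
  qed (simp_all only: link finite_triangle finite_imageI finite_set)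
qed

lemma links_mem:
  assumes "p < N" "next_in (Ls ! p) a b"
  shows "a < N" "b < N"
proof -
  have "{p, a, b} \<in> codes" using link_code[OF assms(1)] assms(2) unfolding is_link_def by blast
  then have "{p, a, b} \<subseteq> {..<N}" unfolding Union_codes[symmetric] by blast
  then show "a < N" "b < N" by auto
qed

lemma orientable:
  assumes "check_coherent Ls"
  shows "orientable_map (cyc ` set fs)"
proof -
  have "orientable_surface (realisation triangles)"
  proof (rule orientable_realisation[where L = links])
    fix p q r assume "p \<in> \<Union>triangles" and nx: "next_in (links p) q r"
    then obtain p' where p': "p' < N" "p = pt p'" unfolding Union_triangles by blast
    then obtain q' r' where q': "next_in (Ls ! p') q' r'" "q = pt q'" "r = pt r'"
      using nx by (auto simp: links_def code_pt next_in_map)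
    then have "next_in (Ls ! q') r' p'"
      using assms p'(1) by (fastforce simp: check_coherent_def arcs_iff)
    then show "next_in (links q) r p"
      using p' q' links_mem[OF p'(1) q'(1)] by (auto simp: links_def code_pt next_in_map)
  qed (use link finite_triangle in auto)
  then show ?thesis using polyhedral by (simp add: orientable_map_def carrier)
qed

text \<open>The witness is a closed edge path whose links are coherent at all steps but the last one, so
that going around it reverses the local orientation.\<close>

lemma nonorientable:
  assumes ps: "ps \<noteq> []" "\<forall>p\<in>set ps. p < N" and co: "successively (coherent_at Ls) ps"
    and rev: "reversed_at Ls (last ps) (hd ps)"
  shows "nonorientable_map (cyc ` set fs)"
proof -
  have "\<not> orientable_surface (realisation triangles)"
  proof
    assume ori: "orientable_surface (realisation triangles)"
    obtain \<epsilon> :: "nat + nat set set \<Rightarrow> complex" where \<epsilon>: "(\<forall>p\<in>\<Union>triangles. \<epsilon> p \<noteq> 0) \<and>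
      (\<forall>p\<in>\<Union>triangles. \<forall>q\<in>\<Union>triangles. \<forall>r. next_in (links p) q r \<longrightarrow>
         (next_in (links q) r p \<longrightarrow> \<epsilon> p = \<epsilon> q) \<and> (next_in (links q) p r \<longrightarrow> \<epsilon> p = - \<epsilon> q))"
      using orientable_realisation_signs[OF finite_triangle link ori] by (rule exE)
    have inT: "pt p \<in> \<Union>triangles" if "p < N" for p using that unfolding Union_triangles by blast
    have nxt: "next_in (links (pt p)) (pt a) (pt b)" if "p < N" "next_in (Ls ! p) a b" for p a b
      using that by (auto simp: links_def code_pt next_in_map)
    have step: "(next_in (links (pt q)) (pt r) (pt p) \<longrightarrow> \<epsilon> (pt p) = \<epsilon> (pt q)) \<and>
        (next_in (links (pt q)) (pt p) (pt r) \<longrightarrow> \<epsilon> (pt p) = - \<epsilon> (pt q))"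
      if pq: "p < N" "q < N" and nx: "next_in (Ls ! p) q r" for p q r
      by (rule mp[OF spec[OF bspec[OF bspec[OF conjunct2[OF \<epsilon>] inT[OF pq(1)]] inT[OF pq(2)]]] nxt[OF pq(1) nx]])
    have same': "\<epsilon> (pt p) = \<epsilon> (pt q)" if pq: "p < N" "q < N" and c: "coherent_at Ls p q" for p q
    proof -
      obtain r where r: "next_in (Ls ! p) q r" "next_in (Ls ! q) r p"
        using c by (auto simp: coherent_at_def arcs_iff)
      then show ?thesis using step[OF pq r(1)] nxt[OF pq(2) r(2)] by simp
    qed
    have opp': "\<epsilon> (pt p) = - \<epsilon> (pt q)" if pq: "p < N" "q < N" and c: "reversed_at Ls p q" for p q
    proof -
      obtain r where r: "next_in (Ls ! p) q r" "next_in (Ls ! q) p r"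
        using c by (auto simp: reversed_at_def arcs_iff)
      then show ?thesis using step[OF pq r(1)] nxt[OF pq(2) r(2)] by simp
    qed
    have "\<epsilon> (pt (hd ps)) = \<epsilon> (pt (last ps))"
      using ps co
    proof (induction ps rule: induct_list012)
      case (3 p q qs)
      then have "\<epsilon> (pt p) = \<epsilon> (pt q)" by (intro same') auto
      then show ?case using 3 by auto
    qed auto
    moreover have "\<epsilon> (pt (last ps)) = - \<epsilon> (pt (hd ps))" using ps rev by (intro opp') auto
    moreover have "\<epsilon> (pt (hd ps)) \<noteq> 0"
      using ps by (intro bspec[OF conjunct1[OF \<epsilon>]] inT) auto
    ultimately show False by simp
  qed
  then show ?thesis using polyhedral by (simp add: nonorientable_map_def carrier)
qed

end

section \<open>Searching for isomorphisms\<close>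

text \<open>A partial injection with domain \<open>{0..<k}\<close> is the list of its values. A value
for the next vertex is kept if every face among \<open>fs\<close> is mapped onto the vertex
set of some face of the target, where vertex sets are represented by sorted lists.\<close>

definition extend_injections :: "nat \<Rightarrow> nat list list \<Rightarrow> nat list list \<Rightarrow> nat list list \<Rightarrow> nat list list" where
  "extend_injections n fs gs yss = concat (map (\<lambda>ys.
     filter (\<lambda>zs. \<forall>xs\<in>set fs. sort (map (\<lambda>v. zs ! v) xs) \<in> set gs)
       (map (\<lambda>y. ys @ [y]) (filter (\<lambda>y. y \<notin> set ys) [0..<n]))) yss)"

text \<open>A face is tested as soon as its last vertex has a value. Comparing vertex sets instead of
cycles only weakens the test.\<close>

primrec partial_isos :: "nat \<Rightarrow> nat list list \<Rightarrow> nat list list \<Rightarrow> nat \<Rightarrow> nat list list" where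
  "partial_isos n fs gs 0 = [[]]" |
  "partial_isos n fs gs (Suc k) =
     extend_injections n (filter (\<lambda>xs. k \<in> set xs \<and> (\<forall>v\<in>set xs. v \<le> k)) fs) gs (partial_isos n fs gs k)"

lemma extend_injectionsI:
  assumes "ys \<in> set yss" "y < n" "y \<notin> set ys"
    and "\<And>xs. xs \<in> set fs \<Longrightarrow> sort (map (\<lambda>v. (ys @ [y]) ! v) xs) \<in> set gs"
  shows "ys @ [y] \<in> set (extend_injections n fs gs yss)"
  unfolding extend_injections_def using assms by (auto intro!: bexI[of _ ys])

lemma partial_isos_complete:
  assumes f: "inj_on f {..<n}" "f ` {..<n} \<subseteq> {..<n}"
    and faces: "\<And>xs. xs \<in> set fs \<Longrightarrow> sort (map f xs) \<in> set gs"
  shows "k \<le> n \<Longrightarrow> map f [0..<k] \<in> set (partial_isos n fs gs k)"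
proof (induction k)
  case (Suc k)
  have k: "f k \<notin> f ` {0..<k}" "f k < n"
  proof -
    show "f k \<notin> f ` {0..<k}"
    proof
      assume "f k \<in> f ` {0..<k}"
      then obtain j where j: "j < k" "f k = f j" by auto
      then have "k = j" using Suc.prems inj_onD[OF f(1) j(2)] by simp
      then show False using j by simp
    qed
    show "f k < n" using f(2) Suc.prems by (simp add: image_subset_iff)
  qed
  have "sort (map (\<lambda>v. map f [0..<Suc k] ! v) xs) \<in> set gs"
    if xs: "xs \<in> set fs" "\<forall>v\<in>set xs. v \<le> k" for xs
  proof -
    have eq: "map (\<lambda>v. map f [0..<Suc k] ! v) xs = map f xs"
      using xs(2) by (auto simp: less_Suc_eq_le simp del: upt_Suc)
    show ?thesis unfolding eq by (rule faces[OF xs(1)])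
  qed
  moreover have "map f [0..<Suc k] = map f [0..<k] @ [f k]" by simp
  moreover have "map f [0..<k] \<in> set (partial_isos n fs gs k)" using Suc by simp
  ultimately show ?case
    unfolding partial_isos.simps using k by (auto intro!: extend_injectionsI simp del: upt_Suc)
qed simp

lemma vertices_cyc: "vertices (cyc ` set fs) = set (concat fs)"
proof -
  have "vertices (cyc ` set fs) = (\<Union>xs\<in>set fs. \<Union> (cyc xs))" unfolding vertices_def by blast
  then show ?thesis by (simp add: Union_cyc)
qed

text \<open>The search does not miss an isomorphism, so an empty list of candidates at some stage
refutes its existence.\<close>

lemma not_isomorphic_by_search:
  assumes fs: "polygon_lists n fs" "\<forall>v\<in>set [0..<n]. v \<in> set (concat fs)"
    and hs: "polygon_lists n hs"
    and search: "partial_isos n fs (map sort hs) k = []" "k \<le> n"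
  shows "\<not> isomorphic_maps (cyc ` set fs) (cyc ` set hs)"
proof
  assume "isomorphic_maps (cyc ` set fs) (cyc ` set hs)"
  then obtain f where bij: "bij_betw f (vertices (cyc ` set fs)) (vertices (cyc ` set hs))"
    and im: "(\<lambda>F. (\<lambda>e. f ` e) ` F) ` cyc ` set fs = cyc ` set hs"
    unfolding isomorphic_maps_def by blast
  have V: "vertices (cyc ` set fs) = {..<n}"
    using fs by (auto simp: vertices_cyc polygon_lists_def)
  have V': "vertices (cyc ` set hs) \<subseteq> {..<n}"
    using hs by (auto simp: vertices_cyc polygon_lists_def)
  have f: "inj_on f {..<n}" "f ` {..<n} \<subseteq> {..<n}"
    using bij V V' by (auto simp: bij_betw_def)
  have "sort (map f xs) \<in> set (map sort hs)" if xs: "xs \<in> set fs" for xs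
  proof -
    have "(\<lambda>e. f ` e) ` cyc xs \<in> cyc ` set hs" using im xs by blast
    then obtain ys where ys: "ys \<in> set hs" "(\<lambda>e. f ` e) ` cyc xs = cyc ys" by blast
    have "f ` set xs = \<Union> ((\<lambda>e. f ` e) ` cyc xs)" unfolding Union_cyc[symmetric] by blast
    then have eq: "set (map f xs) = set ys" by (simp add: ys(2) Union_cyc)
    have "set xs \<subseteq> {..<n}" "distinct xs" using fs xs by (auto simp: polygon_lists_def)
    then have "distinct (map f xs)" using f(1) by (auto simp: distinct_map intro: inj_on_subset)
    moreover have "distinct ys" using hs ys(1) by (auto simp: polygon_lists_def)
    ultimately have "sort (map f xs) = sort ys"
      using eq by (intro sorted_distinct_set_unique) auto
    then show ?thesis using ys(1) by simp
  qed
  then have "map f [0..<k] \<in> set (partial_isos n fs (map sort hs) k)"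
    by (intro partial_isos_complete f search(2))
  then show False using search(1) by simp
qed

section \<open>The three maps\<close>

lemma cyc_arcs: "cyc xs = (\<lambda>(a, b). {a, b}) ` set (arcs xs)"
  by (auto simp: cyc_altdef arcs_iff[symmetric])

lemma cyc_reverse_triangle: "cyc [a, b, c] = cyc [a, c, b]"
  by (simp add: cyc_arcs arcs_def) blast

lemma cyc_reverse_quadrilateral: "cyc [a, b, c, d] = cyc [a, d, c, b]"
  by (simp add: cyc_arcs arcs_def) blast

text \<open>Some faces of the two orientable maps are listed in reverse, so that every edge is traversed
once in each direction.\<close>

definition KO1_faces :: "nat list list" where
  "KO1_faces =
    [[0,1,8,7], [0,7,6,5], [5,6,11,2], [1,3,10,8], [3,4,9,10], [2,11,9,4], [0,5,4],
     [0,2,1], [0,4,3], [0,3,2], [6,7,9], [7,8,11], [7,10,9], [7,11,10], [2,3,5], [1,5,3],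
     [6,10,11], [6,8,10], [1,4,5], [1,2,4], [6,9,8], [8,9,11]]"

text \<open>Entry \<open>v\<close> is the cycle around the vertex \<open>v\<close>, which alternates
between neighbours and apexes of faces.\<close>

definition KO1_vertex_links :: "nat list list" where
  "KO1_vertex_links =
    [[1,12,7,13,5,18,4,20,3,21,2,19], [0,19,2,31,4,30,5,27,3,15,8,12],
     [0,21,3,26,5,14,11,17,4,31,1,19], [0,20,4,16,10,15,1,27,5,26,2,21],
     [0,18,5,30,1,31,2,17,9,16,3,20], [0,13,6,14,2,26,3,27,1,30,4,18],
     [5,13,7,22,9,32,8,29,10,28,11,14], [0,12,8,23,11,25,10,24,9,22,6,13],
     [1,15,10,29,6,32,9,33,11,23,7,12], [4,17,11,33,8,32,6,22,7,24,10,16],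
     [3,16,9,24,7,25,11,28,6,29,8,15], [2,14,6,28,10,25,7,23,8,33,9,17]]"

definition KO2_faces :: "nat list list" where
  "KO2_faces =
    [[0,1,8,7], [0,7,6,5], [5,6,11,3], [1,4,10,8], [4,2,9,10], [3,11,9,2], [0,5,4],
     [0,2,1], [0,4,3], [0,3,2], [6,7,9], [7,8,11], [7,10,9], [7,11,10], [1,3,4], [1,5,3],
     [6,10,11], [6,8,10], [2,4,5], [1,2,5], [6,9,8], [8,9,11]]"

definition KO2_vertex_links :: "nat list list" where
  "KO2_vertex_links =
    [[1,12,7,13,5,18,4,20,3,21,2,19], [0,19,2,31,5,27,3,26,4,15,8,12],
     [0,21,3,17,9,16,4,30,5,31,1,19], [0,20,4,26,1,27,5,14,11,17,2,21],
     [0,18,5,30,2,16,10,15,1,26,3,20], [0,13,6,14,3,27,1,31,2,30,4,18],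
     [5,13,7,22,9,32,8,29,10,28,11,14], [0,12,8,23,11,25,10,24,9,22,6,13],
     [1,15,10,29,6,32,9,33,11,23,7,12], [2,17,11,33,8,32,6,22,7,24,10,16],
     [4,16,9,24,7,25,11,28,6,29,8,15], [3,14,6,28,10,25,7,23,8,33,9,17]]"

definition KNO_faces :: "nat list list" where
  "KNO_faces =
    [[0,1,8,7], [0,5,6,7], [5,6,2,11], [1,8,3,10], [10,3,4,9], [11,2,4,9], [0,4,5],
     [0,1,2], [0,3,4], [0,2,3], [6,7,9], [7,8,11], [7,9,10], [7,10,11], [2,3,6], [3,6,8],
     [5,10,11], [1,5,10], [1,4,5], [1,2,4], [6,8,9], [8,9,11]]"

text \<open>The links of \<open>0\<close>, \<open>1\<close>, \<open>8\<close> and \<open>3\<close> are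
directed so as to be coherent along the edge path through these vertices in this order. The
path closes up with the edge from \<open>3\<close> to \<open>0\<close>, where the directions
disagree.\<close>

definition KNO_vertex_links :: "nat list list" where
  "KNO_vertex_links =
    [[1,12,7,13,5,18,4,20,3,21,2,19], [0,19,2,31,4,30,5,29,10,15,8,12],
     [0,19,1,31,4,17,11,14,6,26,3,21], [0,21,2,26,6,27,8,15,10,16,4,20],
     [0,18,5,30,1,31,2,17,9,16,3,20], [0,13,6,14,11,28,10,29,1,30,4,18],
     [2,14,5,13,7,22,9,32,8,27,3,26], [0,12,8,23,11,25,10,24,9,22,6,13],
     [1,15,3,27,6,32,9,33,11,23,7,12], [4,16,10,24,7,22,6,32,8,33,11,17],
     [1,15,3,16,9,24,7,25,11,28,5,29], [2,14,5,28,10,25,7,23,8,33,9,17]]"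

lemma KO1_eq: "KO1 = cyc ` set KO1_faces"
  unfolding KO1_def KO1_faces_def list.set image_insert image_empty
  by (intro arg_cong2[where f = insert] refl cyc_reverse_triangle cyc_reverse_quadrilateral)

lemma KO2_eq: "KO2 = cyc ` set KO2_faces"
  unfolding KO2_def KO2_faces_def list.set image_insert image_empty
  by (intro arg_cong2[where f = insert] refl cyc_reverse_triangle cyc_reverse_quadrilateral)

lemma KNO_eq: "KNO = cyc ` set KNO_faces"
  unfolding KNO_def KNO_faces_def list.set by (rule refl)

lemma KO1_polygons: "polygon_lists 12 KO1_faces" by code_simp
lemma KO2_polygons: "polygon_lists 12 KO2_faces" by code_simp
lemma KNO_polygons: "polygon_lists 12 KNO_faces" by code_simp

lemma KO1_vertices: "\<forall>v\<in>set [0..<12]. v \<in> set (concat KO1_faces)" by code_simp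
lemma KO2_vertices: "\<forall>v\<in>set [0..<12]. v \<in> set (concat KO2_faces)" by code_simp

lemma KO1_check: "check_map KO1_faces KO1_vertex_links" by code_simp
lemma KO1_coherent: "check_coherent (KO1_vertex_links @ KO1_faces)" by code_simp
lemma KO2_check: "check_map KO2_faces KO2_vertex_links" by code_simp
lemma KO2_coherent: "check_coherent (KO2_vertex_links @ KO2_faces)" by code_simp
lemma KNO_check: "check_map KNO_faces KNO_vertex_links" by code_simp
lemma KNO_one_sided:
  "(\<forall>p\<in>set [0, 1, 8, 3]. p < length KNO_vertex_links + length KNO_faces) \<and>
   successively (coherent_at (KNO_vertex_links @ KNO_faces)) [0, 1, 8, 3] \<and>
   reversed_at (KNO_vertex_links @ KNO_faces) (last [0, 1, 8, 3]) (hd [0, 1, 8, 3])"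
  by code_simp

lemma KO1_orientable: "orientable_map KO1"
  unfolding KO1_eq by (rule checked_map.orientable[OF checked_map.intro[OF KO1_check] KO1_coherent])

lemma KO2_orientable: "orientable_map KO2"
  unfolding KO2_eq by (rule checked_map.orientable[OF checked_map.intro[OF KO2_check] KO2_coherent])

lemma KNO_nonorientable: "nonorientable_map KNO"
  unfolding KNO_eq
  using checked_map.nonorientable[OF checked_map.intro[OF KNO_check], of "[0, 1, 8, 3]"] KNO_one_sided
  by blast

text \<open>The first map can be mapped only as far as vertex \<open>8\<close> into the second one, and both
orientable maps only as far as vertex \<open>4\<close> into the third one.\<close>

lemma KO1_KO2_not_isomorphic: "\<not> isomorphic_maps KO1 KO2"
  unfolding KO1_eq KO2_eq
proof (rule not_isomorphic_by_search[OF KO1_polygons KO1_vertices KO2_polygons])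
  show "partial_isos 12 KO1_faces (map sort KO2_faces) 10 = []" by code_simp
qed simp

lemma KO1_KNO_not_isomorphic: "\<not> isomorphic_maps KO1 KNO"
  unfolding KO1_eq KNO_eq
proof (rule not_isomorphic_by_search[OF KO1_polygons KO1_vertices KNO_polygons])
  show "partial_isos 12 KO1_faces (map sort KNO_faces) 6 = []" by code_simp
qed simp

lemma KO2_KNO_not_isomorphic: "\<not> isomorphic_maps KO2 KNO"
  unfolding KO2_eq KNO_eq
proof (rule not_isomorphic_by_search[OF KO2_polygons KO2_vertices KNO_polygons])
  show "partial_isos 12 KO2_faces (map sort KNO_faces) 6 = []" by code_simp
qed simp

theorem lemma4:
  shows "\<not> isomorphic_maps KO1 KO2 \<and> \<not> isomorphic_maps KO1 KNO \<and> \<not> isomorphic_maps KO2 KNO \<and>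
         orientable_map KO1 \<and> orientable_map KO2 \<and> nonorientable_map KNO"
  using KO1_KO2_not_isomorphic KO1_KNO_not_isomorphic KO2_KNO_not_isomorphic
    KO1_orientable KO2_orientable KNO_nonorientable by blast

end
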